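(* Let $d\ge1$, let $\mathcal{K}$ be either the Čech or the Rips filtration, let $\kappa$ be a density on $[0,1]^d$ with $0<\inf\kappa\le\sup\kappa<\infty$, and for $q\ge0$ let $\mu_q^\kappa$ be the $q$-th persistence diagram of intensity $\kappa$ for the filtration $\mathcal{K}$. Let $\pi_1$ (resp. $\pi_2$) be the projection on the $x$-axis (resp. $y$-axis). Then, for $q>0$, the pushforwards $\pi_1^\star(\mu_q^\kappa)$ and $\pi_2^\star(\mu_q^\kappa)$ have densities with respect to the Lebesgue measure on $\mathbb{R}$. For $q=0$, $\pi_2^\star(\mu_q^\kappa)$ has a density with respect to the Lebesgue measure on $\mathbb{R}$.
   Context: Let $\mathbb{R}^2_>=\{\mathrm{r}=(r_1,r_2)\in\mathbb{R}^2:r_1<r_2\}$, $\mathrm{pers}(\mathrm{r})=r_2-r_1$. A persistence diagram is a multiset $D$ of points of $\mathbb{R}^2_>$, identified with the measure $\sum_{\mathrm{r}\in D}\delta_{\mathrm{r}}$. For finite $\mathbb{X}\subset\mathbb{R}^d$, the Čech filtration is $C^r(\mathbb{X})=\{\sigma\subset\mathbb{X}\text{ finite}:\bigcap_{x\in\sigma}B(x,r)\neq\emptyset\}$, $r\ge0$ ($B(x,r)$ the open Euclidean ball), and the Rips filtration is $R^r(\mathbb{X})=\{\sigma\subset\mathbb{X}\text{ finite}:\mathrm{diam}(\sigma)\le r\}$, $r\ge0$. $\mathrm{dgm}_q[\mathcal{K}(\mathbb{X})]$ is the degree-$q$ persistence diagram (homology over $\mathbb{F}_2$; multiset of birth-death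 pairs) of the filtration; points at infinity are disregarded. Let $(X_i)_{i\ge1}$ be i.i.d. with density $\kappa$ and $(N_i)_{i\ge1}$ an independent sequence of independent Poisson variables, $N_i$ with parameter $i$; $\mathbb{X}_n$ is $\{X_1,\dots,X_n\}$ or $\{X_1,\dots,X_{N_n}\}$, and $\mu_q^n=n^{-1}\mathrm{dgm}_q[\mathcal{K}(n^{1/d}\mathbb{X}_n)]$. The measure $\mu_q^\kappa$ is the unique Radon measure on $\mathbb{R}^2_>$ such that $E[\mu_q^n](\phi)\to\mu_q^\kappa(\phi)$ and, almost surely, $\mu_q^n(\phi)\to\mu_q^\kappa(\phi)$ as $n\to\infty$, for all continuous $\phi:\mathbb{R}^2_>\to\mathbb{R}$ that satisfy $\lim_{\varepsilon\to0}\sup_{\mathrm{pers}(\mathrm{r})\le\varepsilon}|\phi(\mathrm{r})|=0$ and $|\phi(\mathrm{r})|\le A(1+\mathrm{pers}(\mathrm{r})^\alpha)$ for some $A,\alpha>0$. It exists, has finite mass, and does not depend on which of the two choices of $\mathbb{X}_n$ is made. *)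

theory Defs
  imports
    "HOL-Probability.Probability"
    "HOL-Library.Z2"
    "HOL-Library.Function_Algebras"
begin

section \<open>Filtrations\<close>

type_synonym 'a filtration = "real \<Rightarrow> 'a set set"

text \<open>
  Both filtrations are indexed by \<open>r \<ge> 0\<close> in the literature.  For \<open>r < 0\<close> the formulas below
  contain no nonempty simplex, so extending the index set to all reals adds no homology; it only
  makes a birth at time 0 visible as a change at 0.
\<close>

definition cech :: "('a::metric_space) set \<Rightarrow> 'a filtration" where
  "cech X r = {\<sigma>. \<sigma> \<subseteq> X \<and> finite \<sigma> \<and> (\<Inter>x\<in>\<sigma>. ball x r) \<noteq> {}}"

definition rips :: "('a::metric_space) set \<Rightarrow> 'a filtration" where
  "rips X r = {\<sigma>. \<sigma> \<subseteq> X \<and> finite \<sigma> \<and> diameter \<sigma> \<le> r}"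


section \<open>Simplicial homology over the field with two elements\<close>

text \<open>
  A \<open>q\<close>-chain is a function from simplices to \<open>\<F>\<^sub>2\<close> (type \<^typ>\<open>bit\<close>) supported on the
  simplices with \<open>q + 1\<close> vertices.  Homology is unreduced: the empty simplex carries no chain,
  and the boundary of a 0-chain is 0.
\<close>

definition chains :: "'a set set \<Rightarrow> nat \<Rightarrow> ('a set \<Rightarrow> bit) set" where
  "chains K q = {c. \<forall>\<sigma>. c \<sigma> \<noteq> 0 \<longrightarrow> \<sigma> \<in> K \<and> card \<sigma> = Suc q}"

definition boundary :: "('a set \<Rightarrow> bit) \<Rightarrow> 'a set \<Rightarrow> bit" where
  "boundary c = (\<lambda>\<tau>. if \<tau> = {} then 0
      else (\<Sum>\<sigma> | c \<sigma> \<noteq> 0 \<and> (\<exists>x\<in>\<sigma>. \<tau> = \<sigma> - {x}). c \<sigma>))"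

definition cycles :: "'a set set \<Rightarrow> nat \<Rightarrow> ('a set \<Rightarrow> bit) set" where
  "cycles K q = {c \<in> chains K q. boundary c = 0}"

definition boundaries :: "'a set set \<Rightarrow> nat \<Rightarrow> ('a set \<Rightarrow> bit) set" where
  "boundaries K q = boundary ` chains K (Suc q)"

definition chain_scale :: "bit \<Rightarrow> ('a set \<Rightarrow> bit) \<Rightarrow> 'a set \<Rightarrow> bit" where
  "chain_scale a c = (\<lambda>\<sigma>. a * c \<sigma>)"

lemma vector_space_chain_scale: "vector_space chain_scale"
  by unfold_locales (auto simp: chain_scale_def fun_eq_iff algebra_simps)

abbreviation chain_dim :: "('a set \<Rightarrow> bit) set \<Rightarrow> nat" where
  "chain_dim \<equiv> vector_space.dim chain_scale"


section \<open>Persistence diagrams\<close>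

text \<open>
  The rank of \<open>H\<^sub>q(F r) \<rightarrow> H\<^sub>q(F s)\<close> for \<open>r \<le> s\<close>.  The image of this map is the persistent
  homology group \<open>Z\<^sub>q(F r) / (Z\<^sub>q(F r) \<inter> B\<^sub>q(F s))\<close>.
\<close>

definition persistent_betti :: "'a filtration \<Rightarrow> nat \<Rightarrow> real \<Rightarrow> real \<Rightarrow> int" where
  "persistent_betti F q r s =
     int (chain_dim (cycles (F r) q)) - int (chain_dim (cycles (F r) q \<inter> boundaries (F s) q))"

definition R2gt :: "(real \<times> real) set" where
  "R2gt = {r. fst r < snd r}"

definition pers :: "real \<times> real \<Rightarrow> real" where
  "pers r = snd r - fst r"

text \<open>
  Multiplicity of the birth-death pair \<open>(b, d)\<close>, after Cohen-Steiner, Edelsbrunner and Harer: the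
  number of classes that are born in \<open>]b - \<epsilon>, b + \<epsilon>]\<close> and die around \<open>d\<close>, for all small
  \<open>\<epsilon> > 0\<close>.  For a filtration of a finite complex the alternating sum is a natural number that
  is constant for small \<open>\<epsilon>\<close>.  It does not depend on whether a simplex is present at the very
  time it enters (Rips) or only just after (Cech, with open balls).  Classes that never die
  cancel, that is, points at infinity are disregarded.
\<close>

definition dgm :: "'a filtration \<Rightarrow> nat \<Rightarrow> real \<times> real \<Rightarrow> nat" where
  "dgm F q = (\<lambda>(b, d). if b < d then
     (THE m. \<forall>\<^sub>F \<epsilon> in at_right 0.
        int m = persistent_betti F q (b + \<epsilon>) (d - \<epsilon>) - persistent_betti F q (b - \<epsilon>) (d - \<epsilon>)
              - persistent_betti F q (b + \<epsilon>) (d + \<epsilon>) + persistent_betti F q (b - \<epsilon>) (d + \<epsilon>))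
     else 0)"

text \<open>
  The measure \<open>\<Sum>r\<in>D. \<delta>\<^sub>r\<close> on the Borel sets of \<^const>\<open>R2gt\<close>, for a multiset \<open>D\<close> given by its
  multiplicity function (the multisets of \<^theory>\<open>HOL-Library.Multiset\<close> are finite, which a
  persistence diagram need not be).
\<close>

definition diagram_measure :: "(real \<times> real \<Rightarrow> nat) \<Rightarrow> (real \<times> real) measure" where
  "diagram_measure D =
     distr (density (count_space R2gt) (\<lambda>r. of_nat (D r))) (restrict_space borel R2gt) (\<lambda>r. r)"


section \<open>Random samples in the unit cube\<close>

definition unit_cube :: "(real ^ 'n) set" where
  "unit_cube = {x. \<forall>i. 0 \<le> x $ i \<and> x $ i \<le> 1}"

text \<open>
  A probability density on the cube, with \<open>0 < inf \<kappa> \<le> sup \<kappa> < \<infinity>\<close>.  The values of \<open>\<kappa>\<close>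
  outside the cube are irrelevant.
\<close>

definition bounded_density :: "(real ^ 'n \<Rightarrow> real) \<Rightarrow> bool" where
  "bounded_density \<kappa> \<longleftrightarrow>
     (\<lambda>x. \<kappa> x * indicator unit_cube x) \<in> borel_measurable borel \<and>
     (\<integral>\<^sup>+x. ennreal (\<kappa> x * indicator unit_cube x) \<partial>lborel) = 1 \<and>
     (\<exists>a b. 0 < a \<and> (\<forall>x\<in>unit_cube. a \<le> \<kappa> x \<and> \<kappa> x \<le> b))"

text \<open>The sequences \<open>X\<close> and \<open>N\<close> start at index 1; index 0 is unused.\<close>

definition sampling_sequences ::
  "'w measure \<Rightarrow> (real ^ 'n \<Rightarrow> real) \<Rightarrow> (nat \<Rightarrow> 'w \<Rightarrow> real ^ 'n) \<Rightarrow> (nat \<Rightarrow> 'w \<Rightarrow> nat) \<Rightarrow> bool" where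
  "sampling_sequences P \<kappa> X N \<longleftrightarrow>
     prob_space.indep_vars P (\<lambda>_. borel) X {1..} \<and>
     (\<forall>i\<ge>1. distributed P lborel (X i) (\<lambda>x. ennreal (\<kappa> x * indicator unit_cube x))) \<and>
     prob_space.indep_vars P (\<lambda>_. count_space UNIV) N {1..} \<and>
     (\<forall>i\<ge>1. distr P (count_space UNIV) (N i) = measure_pmf (poisson_pmf (real i))) \<and>
     prob_space.indep_set P
       (sets (vimage_algebra (space P) (\<lambda>\<omega>. \<lambda>i\<in>{1..}. X i \<omega>) (\<Pi>\<^sub>M i\<in>{1..}. borel)))
       (sets (vimage_algebra (space P) (\<lambda>\<omega>. \<lambda>i\<in>{1..}. N i \<omega>) (\<Pi>\<^sub>M i\<in>{1..}. count_space UNIV)))"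

datatype scheme = Binomial | Poissonized

primrec sample ::
  "scheme \<Rightarrow> (nat \<Rightarrow> 'w \<Rightarrow> 'a) \<Rightarrow> (nat \<Rightarrow> 'w \<Rightarrow> nat) \<Rightarrow> nat \<Rightarrow> 'w \<Rightarrow> 'a set" where
  "sample Binomial X N n \<omega> = (\<lambda>i. X i \<omega>) ` {1..n}"
| "sample Poissonized X N n \<omega> = (\<lambda>i. X i \<omega>) ` {1..N n \<omega>}"

definition scaled_diagram ::
  "((real ^ 'n) set \<Rightarrow> (real ^ 'n) filtration) \<Rightarrow> nat \<Rightarrow> nat \<Rightarrow> (real ^ 'n) set \<Rightarrow> (real \<times> real) measure" where
  "scaled_diagram K q n S =
     scale_measure (ennreal (1 / real n))
       (diagram_measure (dgm (K ((*\<^sub>R) (real n powr (1 / real CARD('n))) ` S)) q))"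

definition expected_measure :: "'w measure \<Rightarrow> ('w \<Rightarrow> (real \<times> real) measure) \<Rightarrow> (real \<times> real) measure" where
  "expected_measure P M =
     measure_of R2gt (sets (restrict_space borel R2gt)) (\<lambda>A. \<integral>\<^sup>+\<omega>. emeasure (M \<omega>) A \<partial>P)"


section \<open>The persistence diagram of intensity \<open>\<kappa>\<close>\<close>

definition radon_measure_R2gt :: "(real \<times> real) measure \<Rightarrow> bool" where
  "radon_measure_R2gt \<mu> \<longleftrightarrow>
     sets \<mu> = sets (restrict_space borel R2gt) \<and>
     (\<forall>C. compact C \<and> C \<subseteq> R2gt \<longrightarrow> emeasure \<mu> C < \<infinity>) \<and>
     (\<forall>A\<in>sets \<mu>. emeasure \<mu> A = (SUP C\<in>{C. compact C \<and> C \<subseteq> A}. emeasure \<mu> C))"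

definition test_function :: "(real \<times> real \<Rightarrow> real) \<Rightarrow> bool" where
  "test_function \<phi> \<longleftrightarrow>
     continuous_on R2gt \<phi> \<and>
     ((\<lambda>\<epsilon>. SUP r\<in>{r\<in>R2gt. pers r \<le> \<epsilon>}. ennreal \<bar>\<phi> r\<bar>) \<longlongrightarrow> 0) (at_right 0) \<and>
     (\<exists>A>0. \<exists>\<alpha>>0. \<forall>r\<in>R2gt. \<bar>\<phi> r\<bar> \<le> A * (1 + pers r powr \<alpha>))"

definition is_limit_diagram ::
  "'w measure \<Rightarrow> ((real ^ 'n) set \<Rightarrow> (real ^ 'n) filtration) \<Rightarrow> nat \<Rightarrow>
   ('w \<Rightarrow> nat \<Rightarrow> (real ^ 'n) set) \<Rightarrow> (real \<times> real) measure \<Rightarrow> bool" where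
  "is_limit_diagram P K q S \<mu> \<longleftrightarrow>
     radon_measure_R2gt \<mu> \<and>
     (\<forall>\<phi>. test_function \<phi> \<longrightarrow>
        integrable \<mu> \<phi> \<and>
        (\<lambda>n. integral\<^sup>L (expected_measure P (\<lambda>\<omega>. scaled_diagram K q n (S \<omega> n))) \<phi>)
          \<longlonglongrightarrow> integral\<^sup>L \<mu> \<phi> \<and>
        (AE \<omega> in P. (\<lambda>n. integral\<^sup>L (scaled_diagram K q n (S \<omega> n)) \<phi>) \<longlonglongrightarrow> integral\<^sup>L \<mu> \<phi>))"

definition has_lebesgue_density :: "real measure \<Rightarrow> bool" where
  "has_lebesgue_density \<nu> \<longleftrightarrow>
     (\<exists>f::real \<Rightarrow> real. f \<in> borel_measurable borel \<and> (\<forall>x. 0 \<le> f x) \<and>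
        \<nu> = density lborel (\<lambda>x. ennreal (f x)))"

end

theory Submission
  imports Defs
begin

text \<open>
  A birth in the time window \<open>]a, b[\<close> in degree \<open>q\<close> uses up a \<open>q\<close>-simplex that enters the filtration
  between \<open>a\<close> and \<open>b\<close>, and a death uses up such a \<open>(q + 1)\<close>-simplex.  So the expected mass that the
  rescaled diagram gives to a strip is at most \<open>1 / n\<close> times the expected number of \<open>k\<close>-simplices
  entering in the window, with \<open>k = q\<close> or \<open>k = q + 1\<close>.  Both filtrations are invariant under
  translations and homogeneous under dilations; hence the Lebesgue measure of the \<open>k\<close>-tuples that
  form a simplex of parameter \<open>r\<close> with the origin is proportional to \<open>r\<^bsup>dk\<^esup>\<close>, and, as the density
  is bounded, the expected mass of the strip is at most \<open>C (b\<^bsup>dk\<^esup> - a\<^bsup>dk\<^esup>)\<close>, uniformly in \<open>n\<close>.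
  Test functions that approximate the indicator of the strip carry the bound over to \<open>\<mu>\<close>.  For
  \<open>k > 0\<close> the function \<open>r\<^bsup>dk\<^esup>\<close> is locally Lipschitz, so the pushforward is absolutely continuous
  and \<open>\<sigma>\<close>-finite, and the Radon-Nikodym theorem applies.
\<close>

section \<open>Dimensions of spaces of chains\<close>

text \<open>Diagrams are given through alternating sums of ranks, so there is no pairing of
  simplices from which to read off that a birth or a death uses up a simplex. Instead the rank is
  written as dim Z(K) - dim(Z(K) \<inter> B(L)). The first term cancels in the alternating sum, and
  a multiplicity becomes the mixed second difference of dim(Z(K) \<inter> B(L)) across the birth and
  the death time. Submodularity of the dimension makes this difference non-negative and bounds first
  differences by the jumps of dim Z or of dim B, which in turn are bounded by numbers of simplices.
  Over a strip the differences telescope, in the free coordinate and then in the confined one. The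
  other obstacle is that strips reach the diagonal and have discontinuous indicators, whereas test
  functions are continuous and vanish at the diagonal. The bound therefore has the form
  \<open>G b - G a\<close> with \<open>G\<close> continuous, which survives a slight enlargement of
  the strip. Births in degree 0 are excluded because every vertex enters at time 0: there k = 0, and
  the volume argument has no free vertex left.\<close>

lemma (in vector_space) dim_mono_finite:
  assumes "V \<subseteq> W" "W \<subseteq> span S" "finite S"
  shows "dim V \<le> dim W"
proof -
  obtain B where B: "B \<subseteq> W" "independent B" "W \<subseteq> span B" "card B = dim W"
    using basis_exists .
  \<comment> \<open>\<open>dim\<close> is a \<open>card\<close>, hence 0 for an infinite basis; the
    finite spanning set rules this out for the basis of \<open>W\<close>.\<close>
  moreover have "finite B"
    using independent_span_bound[OF assms(3) B(2)] B(1) assms(2) by blast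
  ultimately show ?thesis
    using dim_le_card[of V B] assms(1) by auto
qed

text \<open>A basis \<open>D\<close> of the intersection extends to a basis \<open>C\<close> of
  \<open>W\<close> and to a basis \<open>E\<close> of \<open>U\<close>. The union of
  \<open>E\<close> and \<open>C - D\<close> is independent and lies in \<open>V\<close>, and its
  size gives the inequality.\<close>

lemma (in vector_space) dim_submodular:
  assumes U: "subspace U" and W: "subspace W" and sub: "U \<subseteq> V" "W \<subseteq> V"
    and V: "V \<subseteq> span S" "finite S"
  shows "dim U + dim W \<le> dim V + dim (U \<inter> W)"
proof -
  obtain D where D: "D \<subseteq> U \<inter> W" "independent D" "U \<inter> W \<subseteq> span D" "card D = dim (U \<inter> W)"
    using basis_exists .
  obtain C where C: "D \<subseteq> C" "C \<subseteq> W" "independent C" "W \<subseteq> span C"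
    using maximal_independent_subset_extend[of D W] D by auto
  obtain E where E: "D \<subseteq> E" "E \<subseteq> U" "independent E" "U \<subseteq> span E"
    using maximal_independent_subset_extend[of D U] D by auto
  have "C \<subseteq> span S" "E \<subseteq> span S"
    using C(2) E(2) sub V(1) by auto
  then have fin: "finite C" "finite E" "finite D"
    using independent_span_bound[OF V(2)] C(1,3) E(3) finite_subset by blast+
  have spanE: "span E = U"
    using E U span_minimal by blast
  have "independent (E \<union> F) \<and> E \<inter> F = {}" if "finite F" "F \<subseteq> C - D" for F
    using that
  proof (induction F)
    case (insert v F)
    \<comment> \<open>The vectors of \<open>C - D\<close> are adjoined one at a time. If
      \<open>v = x + y\<close> with \<open>x\<close> in \<open>U\<close> and \<open>y\<close> in the
      span of \<open>F\<close>, then \<open>x = v - y\<close> lies in \<open>W\<close> too, hence in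
      the span of \<open>D\<close>, and \<open>v\<close> would depend on the other vectors of
      \<open>C\<close>.\<close>
    have "v \<notin> span (E \<union> F)"
    proof
      assume "v \<in> span (E \<union> F)"
      then obtain x y where xy: "v = x + y" "x \<in> span E" "y \<in> span F"
        by (auto simp: span_Un)
      have "y \<in> W" "v \<in> W"
        using xy(3) span_minimal[of F W] insert.prems C(2) W by auto
      then have "x \<in> W"
        using xy(1) subspace_diff[OF W] by (metis add_diff_cancel_right')
      then have "x \<in> span D"
        using xy(2) spanE D(3) by auto
      then have "v \<in> span (D \<union> F)"
        using xy by (auto simp: span_Un)
      moreover have "D \<union> F \<subseteq> C - {v}"
        using insert.prems insert.hyps C(1) by auto
      ultimately have "v \<in> span (C - {v})"
        using span_mono by blast
      then show False
        using C(3) insert.prems by (auto simp: dependent_def)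
    qed
    then show ?case
      using insert by (auto simp: independent_insert intro: span_base)
  qed (use E(3) in auto)
  from this[of "C - D"] have ind: "independent (E \<union> (C - D))" "E \<inter> (C - D) = {}"
    using fin by auto
  have "card (E \<union> (C - D)) \<le> dim V"
    using dim_mono_finite[OF _ V, of "E \<union> (C - D)"] dim_eq_card_independent[OF ind(1)] E(2) C(2) sub
    by auto
  moreover have "card (E \<union> (C - D)) = card E + (card C - card D)"
    using card_Un_disjoint[of E "C - D"] ind(2) fin card_Diff_subset[of D C] C(1) by auto
  moreover have "card E = dim U" "card C = dim W" "card D \<le> card C"
    using basis_card_eq_dim[OF E(2,4,3)] basis_card_eq_dim[OF C(2,4,3)] card_mono[OF fin(1) C(1)]
    by auto
  ultimately show ?thesis
    using D(4) by linarith
qed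

interpretation chain: vector_space chain_scale
  by (rule vector_space_chain_scale)

definition simplex_chain :: "'a set \<Rightarrow> 'a set \<Rightarrow> bit" where
  "simplex_chain \<sigma> = (\<lambda>\<tau>. if \<tau> = \<sigma> then 1 else 0)"

text \<open>The only scalars are 0 and 1, so closure under scalar multiplication comes for
  free.\<close>

lemma chain_subspaceI:
  assumes "0 \<in> V" "\<And>c c'. c \<in> V \<Longrightarrow> c' \<in> V \<Longrightarrow> c + c' \<in> V"
  shows "chain.subspace V"
  unfolding chain.subspace_def
proof (intro conjI ballI allI)
  fix a c assume "c \<in> V"
  have "chain_scale a c = (if a = 0 then 0 else c)"
    by (cases a) (auto simp: chain_scale_def fun_eq_iff)
  then show "chain_scale a c \<in> V"
    using assms(1) \<open>c \<in> V\<close> by simp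
qed (use assms in auto)

section \<open>Chains of complexes on a fixed finite vertex set\<close>

locale finite_vertices =
  fixes X :: "'a set"
  assumes finite_vertices: "finite X"
begin

lemma finite_complex: "K \<subseteq> Pow X \<Longrightarrow> finite K"
  using finite_vertices by (auto intro: finite_subset)

text \<open>Summing over a fixed finite set of simplices makes the linearity of the boundary visible.\<close>

lemma boundary_eq:
  assumes "c \<in> chains K q" "K \<subseteq> Pow X"
  shows "boundary c = (\<lambda>\<tau>. if \<tau> = {} then 0 else (\<Sum>\<sigma> | \<sigma> \<in> Pow X \<and> (\<exists>x\<in>\<sigma>. \<tau> = \<sigma> - {x}). c \<sigma>))"
proof (rule ext)
  fix \<tau> :: "'a set"
  have "(\<Sum>\<sigma> | c \<sigma> \<noteq> 0 \<and> (\<exists>x\<in>\<sigma>. \<tau> = \<sigma> - {x}). c \<sigma>)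
      = (\<Sum>\<sigma> | \<sigma> \<in> Pow X \<and> (\<exists>x\<in>\<sigma>. \<tau> = \<sigma> - {x}). c \<sigma>)"
    using finite_vertices assms by (intro sum.mono_neutral_left) (auto simp: chains_def)
  then show "boundary c \<tau> = (if \<tau> = {} then 0 else (\<Sum>\<sigma> | \<sigma> \<in> Pow X \<and> (\<exists>x\<in>\<sigma>. \<tau> = \<sigma> - {x}). c \<sigma>))"
    by (simp add: boundary_def)
qed

lemma chains_add: "c \<in> chains K q \<Longrightarrow> c' \<in> chains K q \<Longrightarrow> c + c' \<in> chains K q"
  unfolding chains_def mem_Collect_eq plus_fun_apply by (metis add.right_neutral)

lemma zero_chains: "0 \<in> chains K q"
  by (simp add: chains_def)

lemma boundary_add:
  assumes "c \<in> chains K q" "c' \<in> chains K q" "K \<subseteq> Pow X"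
  shows "boundary (c + c') = boundary c + boundary c'"
  using boundary_eq[OF chains_add[OF assms(1,2)] assms(3)] boundary_eq[OF assms(1,3)]
    boundary_eq[OF assms(2,3)]
  by (intro ext) (simp only: plus_fun_apply sum.distrib split: if_split, simp)

lemma boundary_zero: "boundary 0 = 0"
  by (auto simp: boundary_def fun_eq_iff)

lemma subspace_cycles:
  assumes "K \<subseteq> Pow X" shows "chain.subspace (cycles K q)"
  by (intro chain_subspaceI)
    (auto simp: cycles_def boundary_zero zero_chains chains_add boundary_add[OF _ _ assms])

lemma subspace_boundaries:
  assumes "K \<subseteq> Pow X" shows "chain.subspace (boundaries K q)"
proof (rule chain_subspaceI)
  show "0 \<in> boundaries K q"
    unfolding boundaries_def by (rule image_eqI[of _ _ 0]) (simp_all add: boundary_zero zero_chains)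
  fix c c' assume "c \<in> boundaries K q" "c' \<in> boundaries K q"
  then obtain e e' where "e \<in> chains K (Suc q)" "e' \<in> chains K (Suc q)" "c = boundary e" "c' = boundary e'"
    by (auto simp: boundaries_def)
  then show "c + c' \<in> boundaries K q"
    unfolding boundaries_def using boundary_add[OF _ _ assms] chains_add
    by (intro image_eqI[of _ _ "e + e'"]) auto
qed

lemma subspace_chains: "chain.subspace (chains K q)"
  using chains_add zero_chains by (intro chain_subspaceI)

lemma chains_mono: "K \<subseteq> L \<Longrightarrow> chains K q \<subseteq> chains L q"
  by (auto simp: chains_def)

lemma cycles_mono: "K \<subseteq> L \<Longrightarrow> cycles K q \<subseteq> cycles L q"
  using chains_mono[of K L q] by (auto simp: cycles_def)

lemma boundaries_mono: "K \<subseteq> L \<Longrightarrow> boundaries K q \<subseteq> boundaries L q"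
  unfolding boundaries_def by (rule image_mono, rule chains_mono)

text \<open>The map \<open>f\<close> will be the identity or the boundary, which is additive only on chains of a finite
  complex.\<close>

lemma image_chains_subset_span:
  assumes "K \<subseteq> L" "L \<subseteq> Pow X"
    and f: "\<And>c c'. c \<in> chains L q \<Longrightarrow> c' \<in> chains L q \<Longrightarrow> f (c + c') = f c + f c'"
  shows "f ` chains L q \<subseteq>
    chain.span (f ` chains K q \<union> (\<lambda>\<sigma>. f (simplex_chain \<sigma>)) ` {\<sigma>\<in>L - K. card \<sigma> = Suc q})"
    (is "_ \<subseteq> chain.span ?S")
proof
  fix e assume "e \<in> f ` chains L q"
  then obtain c where c: "c \<in> chains L q" "e = f c" by auto
  have "finite {\<sigma>\<in>L - K. c \<sigma> \<noteq> 0}"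
    using finite_complex[OF assms(2)] by auto
  then have "f c \<in> chain.span ?S" using c(1)
  proof (induction "{\<sigma>\<in>L - K. c \<sigma> \<noteq> 0}" arbitrary: c rule: finite_induct)
    case empty
    then have "c \<in> chains K q" by (auto simp: chains_def)
    then show ?case by (auto intro!: chain.span_base)
  next
    case (insert \<sigma> F)
    define c' where "c' = c(\<sigma> := 0)"
    have \<sigma>: "\<sigma> \<in> L - K" "c \<sigma> \<noteq> 0" using insert.hyps(4) by auto
    then have card: "card \<sigma> = Suc q" using insert.prems by (auto simp: chains_def)
    have c': "c' \<in> chains L q" and s: "simplex_chain \<sigma> \<in> chains L q"
      using insert.prems \<sigma> card by (auto simp: c'_def chains_def simplex_chain_def split: if_splits)
    have "c = c' + simplex_chain \<sigma>"
      using \<sigma>(2) by (auto simp: c'_def simplex_chain_def fun_eq_iff)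
    then have "f c = f c' + f (simplex_chain \<sigma>)" using f[OF c' s] by simp
    moreover have "F = {\<sigma> \<in> L - K. c' \<sigma> \<noteq> 0}"
      using insert.hyps by (auto simp: c'_def)
    then have "f c' \<in> chain.span ?S" using insert.hyps(3) c' by blast
    moreover have "f (simplex_chain \<sigma>) \<in> chain.span ?S"
      using \<sigma>(1) card by (intro chain.span_base) auto
    ultimately show ?case by (simp add: chain.span_add)
  qed
  then show "e \<in> chain.span ?S" using c by simp
qed

text \<open>The spanning set is chosen before the complex: one finite \<open>S\<close> serves all
  complexes on \<open>X\<close>, so their dimensions can be compared with each other.\<close>

lemma chains_finite_span:
  obtains S where "finite S" "\<And>K. K \<subseteq> Pow X \<Longrightarrow> chains K q \<subseteq> chain.span S"
proof
  let ?S = "simplex_chain ` Pow X :: ('a set \<Rightarrow> bit) set"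
  show "finite ?S" using finite_vertices by simp
  fix K assume "K \<subseteq> Pow X"
  then have "chains K q \<subseteq> chains (Pow X) q" by (rule chains_mono)
  also have "\<dots> \<subseteq> chain.span ((\<lambda>c. c) ` chains {} q \<union> (\<lambda>\<sigma>. simplex_chain \<sigma>) ` {\<sigma>\<in>Pow X - {}. card \<sigma> = Suc q})"
    using image_chains_subset_span[of "{}" "Pow X" q "\<lambda>c. c"] by simp
  also have "chains {} q = {0}"
    by (auto simp: chains_def fun_eq_iff)
  also have "chain.span ((\<lambda>c. c) ` {0} \<union> (\<lambda>\<sigma>. simplex_chain \<sigma>) ` {\<sigma>\<in>Pow X - {}. card \<sigma> = Suc q}) \<subseteq> chain.span (insert 0 ?S)"
    by (rule chain.span_mono) auto
  finally show "chains K q \<subseteq> chain.span ?S" by simp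
qed

lemma boundaries_finite_span:
  obtains S where "finite S" "\<And>K. K \<subseteq> Pow X \<Longrightarrow> boundaries K q \<subseteq> chain.span S"
proof
  let ?S = "(\<lambda>\<sigma>. boundary (simplex_chain \<sigma>)) ` Pow X :: ('a set \<Rightarrow> bit) set"
  show "finite ?S" using finite_vertices by simp
  fix K assume "K \<subseteq> Pow X"
  then have "boundaries K q \<subseteq> boundary ` chains (Pow X) (Suc q)"
    unfolding boundaries_def by (intro image_mono chains_mono)
  also have "\<dots> \<subseteq> chain.span (boundary ` chains {} (Suc q) \<union> (\<lambda>\<sigma>. boundary (simplex_chain \<sigma>)) ` {\<sigma>\<in>Pow X - {}. card \<sigma> = Suc (Suc q)})"
    by (rule image_chains_subset_span) (auto simp: boundary_add)
  also have "chains {} (Suc q) = {0}"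
    by (auto simp: chains_def fun_eq_iff)
  also have "chain.span (boundary ` {0} \<union> (\<lambda>\<sigma>. boundary (simplex_chain \<sigma>)) ` {\<sigma>\<in>Pow X - {}. card \<sigma> = Suc (Suc q)}) \<subseteq> chain.span (insert 0 ?S)"
    by (rule chain.span_mono) (auto simp: boundary_zero)
  finally show "boundaries K q \<subseteq> chain.span ?S" by simp
qed

text \<open>Each new simplex with \<open>q + 1\<close> vertices adds at most one vector to a
  spanning set. The set \<open>S\<close> keeps the basis of the smaller image finite.\<close>

lemma dim_image_chains_le:
  assumes "K \<subseteq> L" "L \<subseteq> Pow X"
    and f: "\<And>c c'. c \<in> chains L q \<Longrightarrow> c' \<in> chains L q \<Longrightarrow> f (c + c') = f c + f c'"
    and S: "f ` chains K q \<subseteq> chain.span S" "finite S"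
  shows "chain_dim (f ` chains L q) \<le> chain_dim (f ` chains K q) + card {\<sigma>\<in>L - K. card \<sigma> = Suc q}"
proof -
  let ?N = "{\<sigma>\<in>L - K. card \<sigma> = Suc q}"
  have "finite ?N" using finite_complex[OF assms(2)] by auto
  obtain B where B: "B \<subseteq> f ` chains K q" "chain.independent B" "f ` chains K q \<subseteq> chain.span B"
      "card B = chain_dim (f ` chains K q)"
    using chain.basis_exists .
  have fB: "finite B"
    using chain.independent_span_bound[OF S(2) B(2)] B(1) S(1) by blast
  let ?T = "B \<union> (\<lambda>\<sigma>. f (simplex_chain \<sigma>)) ` ?N"
  have "f ` chains K q \<union> (\<lambda>\<sigma>. f (simplex_chain \<sigma>)) ` ?N \<subseteq> chain.span ?T"
    using B(3) chain.span_mono[of B ?T] by (auto intro: chain.span_base)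
  then have "f ` chains L q \<subseteq> chain.span ?T"
    using image_chains_subset_span[OF assms(1,2) f] chain.span_minimal[OF _ chain.subspace_span] by blast
  then have "chain_dim (f ` chains L q) \<le> card ?T"
    using fB \<open>finite ?N\<close> by (intro chain.dim_le_card) auto
  also have "\<dots> \<le> card B + card ?N"
    using card_Un_le[of B "(\<lambda>\<sigma>. f (simplex_chain \<sigma>)) ` ?N"] card_image_le[OF \<open>finite ?N\<close>, of "\<lambda>\<sigma>. f (simplex_chain \<sigma>)"]
    by linarith
  finally show ?thesis using B(4) by simp
qed

text \<open>The cycles of \<open>L\<close> that are supported on \<open>K\<close> are exactly the
  cycles of \<open>K\<close>. Submodularity then says that cycles grow by at most as much as chains
  do.\<close>

lemma dim_cycles_le:
  assumes "K \<subseteq> L" "L \<subseteq> Pow X"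
  shows "chain_dim (cycles L q) \<le> chain_dim (cycles K q) + card {\<sigma>\<in>L - K. card \<sigma> = Suc q}"
proof -
  obtain S where S: "finite S" "\<And>K. K \<subseteq> Pow X \<Longrightarrow> chains K q \<subseteq> chain.span S"
    using chains_finite_span[of q] by blast
  have "chain_dim (chains L q) \<le> chain_dim (chains K q) + card {\<sigma>\<in>L - K. card \<sigma> = Suc q}"
    using dim_image_chains_le[OF assms, where f = "\<lambda>c. c" and q = q and S = S] S assms by auto
  moreover have "chain_dim (cycles L q) + chain_dim (chains K q)
      \<le> chain_dim (chains L q) + chain_dim (cycles L q \<inter> chains K q)"
    using subspace_cycles[OF assms(2)] subspace_chains chains_mono[OF assms(1)] S assms
    by (intro chain.dim_submodular[of _ _ _ S]) (auto simp: cycles_def)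
  moreover have "cycles L q \<inter> chains K q = cycles K q"
    using chains_mono[OF assms(1)] by (auto simp: cycles_def)
  ultimately show ?thesis by simp
qed

lemma dim_boundaries_le:
  assumes "K \<subseteq> L" "L \<subseteq> Pow X"
  shows "chain_dim (boundaries L q) \<le> chain_dim (boundaries K q) + card {\<sigma>\<in>L - K. card \<sigma> = Suc (Suc q)}"
proof -
  obtain S where S: "finite S" "\<And>K. K \<subseteq> Pow X \<Longrightarrow> boundaries K q \<subseteq> chain.span S"
    using boundaries_finite_span[of q] by blast
  show ?thesis unfolding boundaries_def
    by (rule dim_image_chains_le[OF assms boundary_add])
      (use S assms in \<open>auto simp: boundaries_def\<close>)
qed

end

section \<open>Points of a persistence diagram and simplices\<close>

context finite_vertices
begin

text \<open>The only part of a persistent Betti number that depends on both times. It is an integer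
  because it enters alternating sums.\<close>

definition zb_dim :: "nat \<Rightarrow> 'a set set \<Rightarrow> 'a set set \<Rightarrow> int" where
  "zb_dim q K L = int (chain_dim (cycles K q \<inter> boundaries L q))"

lemma subspace_cycles_Int_boundaries:
  "K \<subseteq> Pow X \<Longrightarrow> L \<subseteq> Pow X \<Longrightarrow> chain.subspace (cycles K q \<inter> boundaries L q)"
  by (intro chain.subspace_inter subspace_cycles subspace_boundaries)

lemma cycles_finite_span:
  obtains S where "finite S" "\<And>K. K \<subseteq> Pow X \<Longrightarrow> cycles K q \<subseteq> chain.span S"
proof -
  obtain S where S: "finite S" "\<And>K. K \<subseteq> Pow X \<Longrightarrow> chains K q \<subseteq> chain.span S"
    using chains_finite_span[of q] by blast
  show thesis
    by (rule that[OF S(1)]) (use S(2) in \<open>auto simp: cycles_def\<close>)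
qed

lemma zb_dim_mono:
  assumes "K \<subseteq> K'" "K' \<subseteq> Pow X" "L \<subseteq> L'"
  shows "zb_dim q K L \<le> zb_dim q K' L'"
proof -
  obtain S where "finite S" "\<And>K. K \<subseteq> Pow X \<Longrightarrow> cycles K q \<subseteq> chain.span S"
    using cycles_finite_span by blast
  then have "cycles K' q \<inter> boundaries L' q \<subseteq> chain.span S" "finite S" using assms by auto
  from chain.dim_mono_finite[OF _ this, of "cycles K q \<inter> boundaries L q"]
  show ?thesis
    using cycles_mono[OF assms(1), of q] boundaries_mono[OF assms(3), of q]
    unfolding zb_dim_def by auto
qed

text \<open>The two spaces on the left meet in the cycles of \<open>K\<close> that bound in
  \<open>L\<close>, and both lie in the space of cycles of \<open>K'\<close> that bound in
  \<open>L'\<close>. Read as a mixed second difference, this is the non-negativity of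
  multiplicities.\<close>

lemma zb_dim_submodular:
  assumes "K \<subseteq> K'" "K' \<subseteq> Pow X" "L \<subseteq> L'" "L' \<subseteq> Pow X"
  shows "zb_dim q K' L + zb_dim q K L' \<le> zb_dim q K' L' + zb_dim q K L"
proof -
  obtain S where S: "finite S" "\<And>K. K \<subseteq> Pow X \<Longrightarrow> cycles K q \<subseteq> chain.span S"
    using cycles_finite_span by blast
  have mono: "cycles K q \<subseteq> cycles K' q" "boundaries L q \<subseteq> boundaries L' q"
    using cycles_mono[OF assms(1)] boundaries_mono[OF assms(3)] by auto
  have "(cycles K' q \<inter> boundaries L q) \<inter> (cycles K q \<inter> boundaries L' q) = cycles K q \<inter> boundaries L q"
    using mono by auto
  moreover have "chain_dim (cycles K' q \<inter> boundaries L q) + chain_dim (cycles K q \<inter> boundaries L' q)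
    \<le> chain_dim (cycles K' q \<inter> boundaries L' q)
      + chain_dim ((cycles K' q \<inter> boundaries L q) \<inter> (cycles K q \<inter> boundaries L' q))"
    using mono S(2)[OF assms(2)] assms
    by (intro chain.dim_submodular[OF _ _ _ _ _ S(1)] subspace_cycles_Int_boundaries) auto
  ultimately show ?thesis unfolding zb_dim_def by simp
qed

text \<open>Submodularity for the cycles of \<open>K\<close> and the cycles of \<open>K'\<close>
  that bound in \<open>L\<close>. When \<open>K'\<close> is contained in \<open>L\<close>, it says
  that the rank of the map into the homology of \<open>L\<close> does not drop as \<open>K\<close>
  grows.\<close>

lemma zb_dim_diff_le_cycles:
  assumes "K \<subseteq> K'" "K' \<subseteq> Pow X" "L \<subseteq> Pow X"
  shows "int (chain_dim (cycles K q)) + zb_dim q K' L \<le> int (chain_dim (cycles K' q)) + zb_dim q K L"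
proof -
  obtain S where S: "finite S" "\<And>K. K \<subseteq> Pow X \<Longrightarrow> cycles K q \<subseteq> chain.span S"
    using cycles_finite_span by blast
  have mono: "cycles K q \<subseteq> cycles K' q" using cycles_mono[OF assms(1)] by auto
  then have "cycles K q \<inter> (cycles K' q \<inter> boundaries L q) = cycles K q \<inter> boundaries L q"
    by auto
  moreover have "chain_dim (cycles K q) + chain_dim (cycles K' q \<inter> boundaries L q)
    \<le> chain_dim (cycles K' q) + chain_dim (cycles K q \<inter> (cycles K' q \<inter> boundaries L q))"
    using mono S(2)[OF assms(2)] assms
    by (intro chain.dim_submodular[OF _ _ _ _ _ S(1)] subspace_cycles_Int_boundaries subspace_cycles) auto
  ultimately show ?thesis unfolding zb_dim_def by simp
qed

text \<open>Passing from \<open>L\<close> to \<open>L'\<close> cannot kill more independent classes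
  of \<open>K\<close> than there are new independent boundaries.\<close>

lemma zb_dim_diff_le_boundaries:
  assumes "L \<subseteq> L'" "L' \<subseteq> Pow X" "K \<subseteq> Pow X"
  shows "zb_dim q K L' + int (chain_dim (boundaries L q)) \<le> int (chain_dim (boundaries L' q)) + zb_dim q K L"
proof -
  obtain S where S: "finite S" "\<And>K. K \<subseteq> Pow X \<Longrightarrow> boundaries K q \<subseteq> chain.span S"
    using boundaries_finite_span[of q] by blast
  have mono: "boundaries L q \<subseteq> boundaries L' q" using boundaries_mono[OF assms(1)] by auto
  then have "cycles K q \<inter> boundaries L' q \<inter> boundaries L q = cycles K q \<inter> boundaries L q"
    by auto
  moreover have "chain_dim (cycles K q \<inter> boundaries L' q) + chain_dim (boundaries L q)
    \<le> chain_dim (boundaries L' q) + chain_dim (cycles K q \<inter> boundaries L' q \<inter> boundaries L q)"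
    using mono S(2)[OF assms(2)] assms
    by (intro chain.dim_submodular[OF _ _ _ _ _ S(1)] subspace_cycles_Int_boundaries subspace_boundaries) auto
  ultimately show ?thesis unfolding zb_dim_def by simp
qed

end

text \<open>Think of \<open>lo d\<close> and \<open>hi d\<close> as the values of a decreasing
  function just before and just after \<open>d\<close>. Its drops at finitely many points add up to
  at most its range, which lies between 0 and \<open>G\<close>; the drops in between are
  discarded.\<close>

lemma sum_telescope_antimono:
  fixes lo hi :: "'b::linorder \<Rightarrow> int"
  assumes "finite E" "\<And>d d'. d \<in> E \<Longrightarrow> d' \<in> E \<Longrightarrow> d < d' \<Longrightarrow> lo d' \<le> hi d"
    and "\<And>d. d \<in> E \<Longrightarrow> lo d \<le> G" "\<And>d. d \<in> E \<Longrightarrow> 0 \<le> hi d" "0 \<le> G"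
  shows "(\<Sum>d\<in>E. lo d - hi d) \<le> G"
  using assms
proof (induction E arbitrary: G rule: finite_linorder_min_induct)
  case (insert b E)
  have "(\<Sum>d\<in>E. lo d - hi d) \<le> hi b"
    using insert.prems insert.hyps by (intro insert.IH) auto
  moreover have "lo b \<le> G" "b \<notin> E"
    using insert by auto
  ultimately show ?case
    using insert.hyps(1) by simp
qed simp

lemma sum_telescope_mono:
  fixes lo hi :: "'b::linorder \<Rightarrow> int"
  assumes "finite E" "\<And>d d'. d \<in> E \<Longrightarrow> d' \<in> E \<Longrightarrow> d < d' \<Longrightarrow> hi d \<le> lo d'"
    and "\<And>d. d \<in> E \<Longrightarrow> m \<le> lo d" "\<And>d. d \<in> E \<Longrightarrow> hi d \<le> M" "m \<le> M"
  shows "(\<Sum>d\<in>E. hi d - lo d) \<le> M - m"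
  using sum_telescope_antimono[of E "\<lambda>d. M - lo d" "\<lambda>d. M - hi d" "M - m"] assms by simp

section \<open>One-sided limits of a filtration and sums of multiplicities\<close>

locale finite_filtration = finite_vertices X for X :: "'a set" +
  fixes F :: "'a filtration"
  assumes filtration_mono: "r \<le> s \<Longrightarrow> F r \<subseteq> F s"
    and filtration_subset: "F r \<subseteq> Pow X"
begin

text \<open>The right limit of the filtration, as \<open>before\<close> is the left limit.
  Multiplicities see only these two, so it does not matter which of them \<open>F t\<close> equals:
  the left one for open balls (Cech), the right one for the closed condition on diameters
  (Rips).\<close>

definition after :: "real \<Rightarrow> 'a set set" where
  "after t = (\<Inter>r\<in>{t<..}. F r)"

definition before :: "real \<Rightarrow> 'a set set" where
  "before t = (\<Union>r\<in>{..<t}. F r)"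

lemma after_subset: "t < s \<Longrightarrow> after t \<subseteq> F s"
  by (auto simp: after_def)

lemma subset_before: "s < t \<Longrightarrow> F s \<subseteq> before t"
  by (auto simp: before_def)

lemma subset_after: "s \<le> t \<Longrightarrow> F s \<subseteq> after t"
  unfolding after_def by (intro INT_greatest filtration_mono) auto

lemma before_subset: "t \<le> s \<Longrightarrow> before t \<subseteq> F s"
  unfolding before_def by (intro UN_least filtration_mono) auto

lemma before_subset_after: "before t \<subseteq> after t"
  using before_subset[of t t] subset_after[of t t] by auto

lemma after_subset_before: "s < t \<Longrightarrow> after s \<subseteq> before t"
  using after_subset[of s "(s + t) / 2"] subset_before[of "(s + t) / 2" t] by force

lemma after_Pow: "after t \<subseteq> Pow X"
  using after_subset[of t "t + 1"] filtration_subset[of "t + 1"] by simp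

lemma before_Pow: "before t \<subseteq> Pow X"
  using before_subset_after after_Pow by (rule subset_trans)

text \<open>A simplex outside the right limit is missing from some \<open>F r\<close> with
  \<open>r > t\<close>, hence from every earlier complex. As there are finitely many candidate
  simplices, one \<epsilon> works for all.\<close>

lemma eventually_after: "\<forall>\<^sub>F \<epsilon> in at_right 0. F (t + \<epsilon>) = after t"
proof -
  have "\<forall>\<^sub>F \<epsilon> in at_right 0. \<sigma> \<in> F (t + \<epsilon>) \<longrightarrow> \<sigma> \<in> after t" for \<sigma>
  proof (cases "\<sigma> \<in> after t")
    case False
    then obtain r where r: "r > t" "\<sigma> \<notin> F r" by (auto simp: after_def)
    have "\<forall>\<^sub>F \<epsilon> in at_right 0. \<epsilon> < r - t"
      using \<open>r > t\<close> by (intro order_tendstoD(2)[OF tendsto_ident_at]) auto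
    then show ?thesis
    proof eventually_elim
      case (elim \<epsilon>)
      then show ?case using filtration_mono[of "t + \<epsilon>" r] r(2) by auto
    qed
  qed simp
  then have "\<forall>\<^sub>F \<epsilon> in at_right 0. \<forall>\<sigma>\<in>Pow X. \<sigma> \<in> F (t + \<epsilon>) \<longrightarrow> \<sigma> \<in> after t"
    using finite_vertices by (intro eventually_ball_finite) auto
  moreover have "\<forall>\<^sub>F \<epsilon> in at_right (0::real). \<epsilon> > 0"
    by (rule eventually_at_right_less)
  ultimately show ?thesis
  proof eventually_elim
    case (elim \<epsilon>)
    then show ?case using after_subset[of t "t + \<epsilon>"] filtration_subset[of "t + \<epsilon>"] by auto
  qed
qed

lemma eventually_before: "\<forall>\<^sub>F \<epsilon> in at_right 0. F (t - \<epsilon>) = before t"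
proof -
  have "\<forall>\<^sub>F \<epsilon> in at_right 0. \<sigma> \<in> before t \<longrightarrow> \<sigma> \<in> F (t - \<epsilon>)" for \<sigma>
  proof (cases "\<sigma> \<in> before t")
    case True
    then obtain r where r: "r < t" "\<sigma> \<in> F r" by (auto simp: before_def)
    have "\<forall>\<^sub>F \<epsilon> in at_right 0. \<epsilon> < t - r"
      using \<open>r < t\<close> by (intro order_tendstoD(2)[OF tendsto_ident_at]) auto
    then show ?thesis
    proof eventually_elim
      case (elim \<epsilon>)
      then show ?case using filtration_mono[of r "t - \<epsilon>"] r(2) by auto
    qed
  qed simp
  then have "\<forall>\<^sub>F \<epsilon> in at_right 0. \<forall>\<sigma>\<in>Pow X. \<sigma> \<in> before t \<longrightarrow> \<sigma> \<in> F (t - \<epsilon>)"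
    using finite_vertices by (intro eventually_ball_finite) auto
  moreover have "\<forall>\<^sub>F \<epsilon> in at_right (0::real). \<epsilon> > 0"
    by (rule eventually_at_right_less)
  ultimately show ?thesis
  proof eventually_elim
    case (elim \<epsilon>)
    then show ?case using subset_before[of "t - \<epsilon>" t] before_Pow[of t] by auto
  qed
qed

text \<open>For small \<epsilon> the four complexes are the one-sided limits, and the cycle
  dimensions cancel because each depends on the first time only. Submodularity makes the remaining
  integer non-negative, so it is a natural number, and the definite description has it as its unique
  solution because \<open>at_right 0\<close> is a proper filter.\<close>

lemma dgm_eq:
  assumes "b < d"
  shows "int (dgm F q (b, d)) = zb_dim q (after b) (after d) - zb_dim q (before b) (after d)
    - zb_dim q (after b) (before d) + zb_dim q (before b) (before d)"
    (is "_ = ?R")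
proof -
  have "?R \<ge> 0"
    using zb_dim_submodular[OF before_subset_after after_Pow before_subset_after after_Pow, of q b d]
    by simp
  then have R: "int (nat ?R) = ?R" by simp
  have "\<forall>\<^sub>F \<epsilon> in at_right 0. persistent_betti F q (b + \<epsilon>) (d - \<epsilon>) - persistent_betti F q (b - \<epsilon>) (d - \<epsilon>)
      - persistent_betti F q (b + \<epsilon>) (d + \<epsilon>) + persistent_betti F q (b - \<epsilon>) (d + \<epsilon>) = int (nat ?R)"
    using eventually_after[of b] eventually_before[of b] eventually_after[of d] eventually_before[of d]
    unfolding R by eventually_elim (simp add: persistent_betti_def zb_dim_def)
  then have "(\<forall>\<^sub>F \<epsilon> in at_right 0.
        int m = persistent_betti F q (b + \<epsilon>) (d - \<epsilon>) - persistent_betti F q (b - \<epsilon>) (d - \<epsilon>)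
              - persistent_betti F q (b + \<epsilon>) (d + \<epsilon>) + persistent_betti F q (b - \<epsilon>) (d + \<epsilon>))
      \<longleftrightarrow> (\<forall>\<^sub>F \<epsilon> in at_right (0::real). int m = int (nat ?R))" for m
    by (rule eventually_subst[OF eventually_mono]) simp
  then have ev: "(\<forall>\<^sub>F \<epsilon> in at_right 0.
        int m = persistent_betti F q (b + \<epsilon>) (d - \<epsilon>) - persistent_betti F q (b - \<epsilon>) (d - \<epsilon>)
              - persistent_betti F q (b + \<epsilon>) (d + \<epsilon>) + persistent_betti F q (b - \<epsilon>) (d + \<epsilon>))
      \<longleftrightarrow> m = nat ?R" for m
    by (simp only: eventually_const[OF trivial_limit_at_right_real] of_nat_eq_iff)
  have "dgm F q (b, d) = (THE m. m = nat ?R)"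
    unfolding dgm_def using assms by (simp only: ev split if_True)
  then show ?thesis using R by simp
qed

lemma dgm_sum_deaths_le:
  assumes "finite Y" "\<And>y. y \<in> Y \<Longrightarrow> x < y"
  shows "(\<Sum>y\<in>Y. int (dgm F q (x, y)))
    \<le> int (chain_dim (cycles (after x) q)) - int (chain_dim (cycles (before x) q))"
proof -
  \<comment> \<open>\<open>g L\<close> counts the classes born at \<open>x\<close> that do not yet
    bound in \<open>L\<close>. It decreases as \<open>L\<close> grows, and its drop at time
    \<open>y\<close> is the multiplicity of \<open>(x, y)\<close>.\<close>
  define g where "g L = int (chain_dim (cycles (after x) q)) - int (chain_dim (cycles (before x) q))
    - zb_dim q (after x) L + zb_dim q (before x) L" for L
  have g_mono: "g L' \<le> g L" if "L \<subseteq> L'" "L' \<subseteq> Pow X" for L L'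
    using zb_dim_submodular[OF before_subset_after[of x] after_Pow that, of q] by (simp add: g_def)
  have g_nonneg: "0 \<le> g L" if "L \<subseteq> Pow X" for L
    using zb_dim_diff_le_cycles[OF before_subset_after[of x] after_Pow that, of q] by (simp add: g_def)
  have g_le: "g L \<le> int (chain_dim (cycles (after x) q)) - int (chain_dim (cycles (before x) q))" for L
    using zb_dim_mono[OF before_subset_after[of x] after_Pow order_refl, of q L] by (simp add: g_def)
  have "(\<Sum>y\<in>Y. int (dgm F q (x, y))) = (\<Sum>y\<in>Y. g (before y) - g (after y))"
    using assms(2) by (intro sum.cong) (auto simp: dgm_eq g_def)
  also have "\<dots> \<le> int (chain_dim (cycles (after x) q)) - int (chain_dim (cycles (before x) q))"
    \<comment> \<open>The empty complex yields that the total jump is non-negative, as the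
      telescoping lemma requires.\<close>
    using g_nonneg[of "{}"] g_le[of "{}"]
    by (intro sum_telescope_antimono assms g_mono g_nonneg g_le after_subset_before before_Pow after_Pow)
      auto
  finally show ?thesis .
qed

lemma dgm_sum_births_le:
  assumes "finite Y" "\<And>x. x \<in> Y \<Longrightarrow> x < y"
  shows "(\<Sum>x\<in>Y. int (dgm F q (x, y)))
    \<le> int (chain_dim (boundaries (after y) q)) - int (chain_dim (boundaries (before y) q))"
proof -
  \<comment> \<open>\<open>h K\<close> counts the classes of cycles of \<open>K\<close> that die at
    \<open>y\<close>. It increases with \<open>K\<close>, and its jump at time \<open>x\<close> is
    the multiplicity of \<open>(x, y)\<close>.\<close>
  define h where "h K = zb_dim q K (after y) - zb_dim q K (before y)" for K
  have h_mono: "h K \<le> h K'" if "K \<subseteq> K'" "K' \<subseteq> Pow X" for K K'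
    using zb_dim_submodular[OF that before_subset_after[of y] after_Pow, of q] by (simp add: h_def)
  have h_nonneg: "0 \<le> h K" if "K \<subseteq> Pow X" for K
    using zb_dim_mono[OF order_refl that before_subset_after, of q y] by (simp add: h_def)
  have h_le: "h K \<le> int (chain_dim (boundaries (after y) q)) - int (chain_dim (boundaries (before y) q))"
    if "K \<subseteq> Pow X" for K
    using zb_dim_diff_le_boundaries[OF before_subset_after after_Pow that, of q y] by (simp add: h_def)
  have "(\<Sum>x\<in>Y. int (dgm F q (x, y))) = (\<Sum>x\<in>Y. h (after x) - h (before x))"
    using assms(2) by (intro sum.cong) (auto simp: dgm_eq h_def)
  also have "\<dots> \<le> int (chain_dim (boundaries (after y) q)) - int (chain_dim (boundaries (before y) q)) - 0"
    using h_nonneg[of "{}"] h_le[of "{}"]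
    by (intro sum_telescope_mono assms h_mono h_nonneg h_le after_subset_before before_Pow after_Pow)
      auto
  finally show ?thesis by simp
qed

lemma chain_dim_cycles_mono:
  assumes "K \<subseteq> L" "L \<subseteq> Pow X"
  shows "chain_dim (cycles K q) \<le> chain_dim (cycles L q)"
  using cycles_finite_span[of q] chain.dim_mono_finite cycles_mono[OF assms(1)] assms(2) by metis

lemma chain_dim_boundaries_mono:
  assumes "K \<subseteq> L" "L \<subseteq> Pow X"
  shows "chain_dim (boundaries K q) \<le> chain_dim (boundaries L q)"
  using boundaries_finite_span[of q] chain.dim_mono_finite boundaries_mono[OF assms(1)] assms(2) by metis

text \<open>Grouped by birth time, the sum is at most a sum of jumps of the cycle dimension, which
  telescopes once more between \<open>a'\<close> and \<open>b'\<close>. The strict inequalities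
  place both one-sided limits at a birth time between \<open>F a'\<close> and
  \<open>F b'\<close>.\<close>

lemma dgm_sum_birth_in_le:
  assumes S: "finite S" "S \<subseteq> R2gt" "\<And>r. r \<in> S \<Longrightarrow> a' < fst r \<and> fst r < b'" and "a' \<le> b'"
  shows "(\<Sum>r\<in>S. dgm F q r) \<le> card {\<sigma>\<in>F b' - F a'. card \<sigma> = Suc q}"
proof -
  let ?z = "\<lambda>K. int (chain_dim (cycles K q))"
  have fin: "finite {y. (x, y) \<in> S}" for x
    using finite_subset[of "{y. (x, y) \<in> S}" "snd ` S"] S(1) by force
  have "int (\<Sum>r\<in>S. dgm F q r) = (\<Sum>x\<in>fst ` S. \<Sum>y\<in>{y. (x, y) \<in> S}. int (dgm F q (x, y)))"
  proof -
    have "S = Sigma (fst ` S) (\<lambda>x. {y. (x, y) \<in> S})" by force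
    then have "int (\<Sum>r\<in>S. dgm F q r) = (\<Sum>r\<in>Sigma (fst ` S) (\<lambda>x. {y. (x, y) \<in> S}). int (dgm F q r))"
      by simp
    also have "\<dots> = (\<Sum>x\<in>fst ` S. \<Sum>y\<in>{y. (x, y) \<in> S}. int (dgm F q (x, y)))"
      using S(1) fin by (subst sum.Sigma) auto
    finally show ?thesis .
  qed
  also have "\<dots> \<le> (\<Sum>x\<in>fst ` S. ?z (after x) - ?z (before x))"
    using S(2) fin by (intro sum_mono dgm_sum_deaths_le) (auto simp: R2gt_def)
  also have "\<dots> \<le> ?z (F b') - ?z (F a')"
    using S(1,3) assms(4)
    by (intro sum_telescope_mono)
      (auto intro!: chain_dim_cycles_mono after_subset_before before_Pow filtration_subset
        subset_before after_subset filtration_mono)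
  also have "\<dots> \<le> int (card {\<sigma>\<in>F b' - F a'. card \<sigma> = Suc q})"
    using dim_cycles_le[OF filtration_mono[OF assms(4)] filtration_subset, of q] by simp
  finally show ?thesis by linarith
qed

lemma dgm_sum_death_in_le:
  assumes S: "finite S" "S \<subseteq> R2gt" "\<And>r. r \<in> S \<Longrightarrow> a' < snd r \<and> snd r < b'" and "a' \<le> b'"
  shows "(\<Sum>r\<in>S. dgm F q r) \<le> card {\<sigma>\<in>F b' - F a'. card \<sigma> = Suc (Suc q)}"
proof -
  let ?z = "\<lambda>K. int (chain_dim (boundaries K q))"
  have fin: "finite {x. (x, y) \<in> S}" for y
    using finite_subset[of "{x. (x, y) \<in> S}" "fst ` S"] S(1) by force
  have "int (\<Sum>r\<in>S. dgm F q r) = (\<Sum>y\<in>snd ` S. \<Sum>x\<in>{x. (x, y) \<in> S}. int (dgm F q (x, y)))"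
  proof -
    have "(\<Sum>y\<in>snd ` S. \<Sum>x\<in>{x. (x, y) \<in> S}. int (dgm F q (x, y)))
        = (\<Sum>(y, x)\<in>Sigma (snd ` S) (\<lambda>y. {x. (x, y) \<in> S}). int (dgm F q (x, y)))"
      using S(1) fin by (subst sum.Sigma) auto
    also have "\<dots> = (\<Sum>r\<in>S. int (dgm F q r))"
      by (rule sum.reindex_bij_witness[of _ prod.swap prod.swap]) force+
    finally show ?thesis by simp
  qed
  also have "\<dots> \<le> (\<Sum>y\<in>snd ` S. ?z (after y) - ?z (before y))"
    using S(2) fin by (intro sum_mono dgm_sum_births_le) (auto simp: R2gt_def)
  also have "\<dots> \<le> ?z (F b') - ?z (F a')"
    using S(1,3) assms(4)
    by (intro sum_telescope_mono)
      (auto intro!: chain_dim_boundaries_mono after_subset_before before_Pow filtration_subset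
        subset_before after_subset filtration_mono)
  also have "\<dots> \<le> int (card {\<sigma>\<in>F b' - F a'. card \<sigma> = Suc (Suc q)})"
    using dim_boundaries_le[OF filtration_mono[OF assms(4)] filtration_subset, of q] by simp
  finally show ?thesis by linarith
qed

end

text \<open>Natural weights are at least 1 where they do not vanish, so the bound on finite sums
  leaves at most \<open>c\<close> points in the support, and the integral is itself such a finite
  sum.\<close>

lemma nn_integral_count_space_nat_le:
  fixes D :: "'a \<Rightarrow> nat"
  assumes "\<And>S. finite S \<Longrightarrow> S \<subseteq> A \<Longrightarrow> (\<Sum>x\<in>S. D x) \<le> c"
  shows "(\<integral>\<^sup>+x. of_nat (D x) \<partial>count_space A) \<le> of_nat c"
proof -
  have fin: "finite {x\<in>A. D x > 0}"
  proof (rule ccontr)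
    assume "infinite {x\<in>A. D x > 0}"
    then obtain S where S: "S \<subseteq> {x\<in>A. D x > 0}" "finite S" "card S = Suc c"
      using infinite_arbitrarily_large by blast
    have "Suc c = (\<Sum>x\<in>S. 1)" using S by simp
    also have "\<dots> \<le> (\<Sum>x\<in>S. D x)" using S by (intro sum_mono) (auto simp: Suc_le_eq)
    also have "\<dots> \<le> c" using S by (intro assms) auto
    finally show False by simp
  qed
  have eq: "{x\<in>A. (of_nat (D x) :: ennreal) > 0} = {x\<in>A. D x > 0}" by auto
  have "(\<integral>\<^sup>+x. of_nat (D x) \<partial>count_space A) = (\<Sum>x | x \<in> A \<and> (of_nat (D x) :: ennreal) > 0. of_nat (D x))"
    using fin unfolding eq by (subst nn_integral_count_space) (simp_all add: eq)
  also have "\<dots> = of_nat (\<Sum>x | x \<in> A \<and> D x > 0. D x)"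
    unfolding eq of_nat_sum ..
  also have "\<dots> \<le> of_nat c"
    using assms[of "{x\<in>A. D x > 0}"] fin by (intro of_nat_mono) auto
  finally show ?thesis .
qed

lemma emeasure_diagram_measure_le:
  assumes "A \<in> sets (restrict_space borel R2gt)"
    and "\<And>S. finite S \<Longrightarrow> S \<subseteq> A \<Longrightarrow> (\<Sum>r\<in>S. D r) \<le> c"
  shows "emeasure (diagram_measure D) A \<le> of_nat c"
proof -
  have A: "A \<subseteq> R2gt" using sets.sets_into_space[OF assms(1)] by (simp add: space_restrict_space)
  then have "(\<lambda>r. r) -` A \<inter> R2gt = A" by auto
  then have "emeasure (diagram_measure D) A = emeasure (density (count_space R2gt) (\<lambda>r. of_nat (D r))) A"
    unfolding diagram_measure_def using assms(1)
    by (subst emeasure_distr) (auto simp: space_restrict_space)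
  also have "\<dots> = (\<integral>\<^sup>+r. of_nat (D r) * indicator A r \<partial>count_space R2gt)"
    using A by (subst emeasure_density) auto
  also have "\<dots> = (\<integral>\<^sup>+r. of_nat (D r * indicator A r) \<partial>count_space R2gt)"
    by (intro nn_integral_cong) (auto split: split_indicator)
  also have "\<dots> \<le> of_nat c"
  proof (rule nn_integral_count_space_nat_le)
    fix S :: "(real \<times> real) set" assume S: "finite S" "S \<subseteq> R2gt"
    have "(\<Sum>r\<in>S. D r * indicator A r) = (\<Sum>r\<in>S \<inter> A. D r)"
      using S(1) by (intro sum.mono_neutral_cong_right) (auto split: split_indicator)
    also have "\<dots> \<le> c" using S by (intro assms(2)) auto
    finally show "(\<Sum>r\<in>S. D r * indicator A r) \<le> c" .
  qed
  finally show ?thesis .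
qed

section \<open>Homogeneous filtrations\<close>

text \<open>All that the volume estimate uses about the Cech and the Rips filtration. The factor 2
  in \<open>simplex_dist\<close> is the triangle inequality through the centre of a Cech simplex;
  Rips simplices satisfy it a fortiori.\<close>

locale homogeneous_filtration =
  fixes K :: "('a::euclidean_space) set \<Rightarrow> 'a filtration"
  assumes simplex_iff: "\<sigma> \<in> K X r \<longleftrightarrow> \<sigma> \<subseteq> X \<and> \<sigma> \<in> K UNIV r"
    and simplex_mono: "r \<le> s \<Longrightarrow> K X r \<subseteq> K X s"
    and simplex_translate: "\<sigma> \<in> K UNIV r \<Longrightarrow> (+) v ` \<sigma> \<in> K UNIV r"
    and simplex_scale: "\<sigma> \<in> K UNIV r \<Longrightarrow> t > 0 \<Longrightarrow> (*\<^sub>R) t ` \<sigma> \<in> K UNIV (t * r)"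
    and simplex_dist: "\<sigma> \<in> K UNIV r \<Longrightarrow> x \<in> \<sigma> \<Longrightarrow> y \<in> \<sigma> \<Longrightarrow> dist x y \<le> 2 * r"
    and simplex_measurable: "finite I \<Longrightarrow> I \<noteq> {} \<Longrightarrow>
      {x \<in> space (\<Pi>\<^sub>M i\<in>I. borel). x ` I \<in> K UNIV r} \<in> sets (\<Pi>\<^sub>M (i::nat)\<in>I. borel)"

lemma cech_iff:
  "\<sigma> \<in> cech X r \<longleftrightarrow> \<sigma> \<subseteq> X \<and> finite \<sigma> \<and> (\<exists>z. \<forall>x\<in>\<sigma>. dist x z < r)"
proof -
  have "(\<Inter>x\<in>\<sigma>. ball x r) \<noteq> {} \<longleftrightarrow> (\<exists>z. \<forall>x\<in>\<sigma>. dist x z < r)"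
    unfolding ex_in_conv[symmetric] by simp
  then show ?thesis by (simp add: cech_def)
qed

lemma dist_scaleR: "0 < t \<Longrightarrow> dist (t *\<^sub>R x) (t *\<^sub>R y) = t * dist x (y :: 'a::real_normed_vector)"
  by (simp add: dist_norm flip: scaleR_right_diff_distrib)

lemma homogeneous_filtration_cech:
  "homogeneous_filtration (cech :: ('a::euclidean_space) set \<Rightarrow> 'a filtration)"
proof
  fix \<sigma> X :: "'a set" and r s t :: real and v x y :: 'a and I :: "nat set"
  show "\<sigma> \<in> cech X r \<longleftrightarrow> \<sigma> \<subseteq> X \<and> \<sigma> \<in> cech UNIV r"
    by (auto simp: cech_iff)
  show "cech X r \<subseteq> cech X s" if "r \<le> s"
    unfolding cech_iff subset_iff using that less_le_trans by blast
  show "(+) v ` \<sigma> \<in> cech UNIV r" if \<sigma>: "\<sigma> \<in> cech UNIV r"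
  proof -
    from \<sigma> obtain z where "finite \<sigma>" "\<forall>x\<in>\<sigma>. dist x z < r" by (auto simp: cech_iff)
    then show ?thesis unfolding cech_iff by (auto intro!: exI[of _ "v + z"])
  qed
  show "(*\<^sub>R) t ` \<sigma> \<in> cech UNIV (t * r)" if \<sigma>: "\<sigma> \<in> cech UNIV r" "t > 0"
  proof -
    from \<sigma> obtain z where "finite \<sigma>" "\<forall>x\<in>\<sigma>. dist x z < r" by (auto simp: cech_iff)
    then show ?thesis unfolding cech_iff using \<sigma>(2) by (auto intro!: exI[of _ "t *\<^sub>R z"] simp: dist_scaleR)
  qed
  show "dist x y \<le> 2 * r" if \<sigma>: "\<sigma> \<in> cech UNIV r" "x \<in> \<sigma>" "y \<in> \<sigma>"
  proof -
    from \<sigma> obtain z where "dist x z < r" "dist y z < r" by (auto simp: cech_iff)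
    then show ?thesis using dist_triangle2[of x y z] by linarith
  qed
  show "{x \<in> space (\<Pi>\<^sub>M i\<in>I. borel). x ` I \<in> cech UNIV r} \<in> sets (\<Pi>\<^sub>M (i::nat)\<in>I. (borel :: 'a measure))"
    if I: "finite I"
  proof -
    \<comment> \<open>The possible centres \<open>z\<close> form an open set, being a finite
      intersection of open balls, so \<open>z\<close> can be taken from a countable dense set; this
      turns the condition into a countable union.\<close>
    obtain D :: "'a set" where D: "countable D" "\<And>A. open A \<Longrightarrow> A \<noteq> {} \<Longrightarrow> \<exists>d\<in>D. d \<in> A"
      by (rule countable_dense_setE) blast
    have "x ` I \<in> cech UNIV r \<longleftrightarrow> (\<exists>z\<in>D. \<forall>i\<in>I. dist (x i) z < r)" for x :: "nat \<Rightarrow> 'a"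
    proof
      assume "x ` I \<in> cech UNIV r"
      then obtain z where "\<forall>i\<in>I. dist (x i) z < r" by (auto simp: cech_iff)
      then have "(\<Inter>i\<in>I. ball (x i) r) \<noteq> {}" unfolding ex_in_conv[symmetric] by auto
      moreover have "open (\<Inter>i\<in>I. ball (x i) r)" using I by (intro open_INT) auto
      ultimately obtain d where "d \<in> D" "d \<in> (\<Inter>i\<in>I. ball (x i) r)" using D(2) by blast
      then show "\<exists>z\<in>D. \<forall>i\<in>I. dist (x i) z < r" by auto
    next
      assume "\<exists>z\<in>D. \<forall>i\<in>I. dist (x i) z < r"
      then show "x ` I \<in> cech UNIV r" using I unfolding cech_iff by auto
    qed
    then have "{x \<in> space (\<Pi>\<^sub>M i\<in>I. borel). x ` I \<in> cech UNIV r}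
        = {x \<in> space (\<Pi>\<^sub>M i\<in>I. borel). \<exists>z\<in>D. \<forall>i\<in>I. dist (x i) z < r}" by simp
    also have "\<dots> \<in> sets (\<Pi>\<^sub>M (i::nat)\<in>I. (borel :: 'a measure))"
      using D(1) I by measurable
    finally show ?thesis .
  qed
qed

lemma homogeneous_filtration_rips:
  "homogeneous_filtration (rips :: ('a::euclidean_space) set \<Rightarrow> 'a filtration)"
proof -
  \<comment> \<open>The empty simplex is treated apart: its \<open>diameter\<close> is 0 by
    convention, so it is absent for negative \<open>r\<close>, while the condition on pairs would be
    vacuous.\<close>
  have iff: "\<sigma> \<in> rips X r \<longleftrightarrow> \<sigma> \<subseteq> X \<and> finite \<sigma> \<and> (if \<sigma> = {} then 0 \<le> r else \<forall>x\<in>\<sigma>. \<forall>y\<in>\<sigma>. dist x y \<le> r)"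
    for \<sigma> X :: "'a set" and r
  proof (cases "finite \<sigma> \<and> \<sigma> \<noteq> {}")
    case True
    have "dist x y \<le> diameter \<sigma>" if "x \<in> \<sigma>" "y \<in> \<sigma>" for x y
      using that True by (intro diameter_bounded_bound finite_imp_bounded) auto
    moreover have "diameter \<sigma> \<le> r" if "\<forall>x\<in>\<sigma>. \<forall>y\<in>\<sigma>. dist x y \<le> r"
      using that True by (intro diameter_le) (auto simp: dist_norm)
    ultimately show ?thesis using True by (auto simp: rips_def) (meson order_trans)
  qed (auto simp: rips_def)
  show ?thesis
  proof
    fix \<sigma> X :: "'a set" and r s t :: real and v x y :: 'a and I :: "nat set"
    show "\<sigma> \<in> rips X r \<longleftrightarrow> \<sigma> \<subseteq> X \<and> \<sigma> \<in> rips UNIV r"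
      by (auto simp: rips_def)
    show "rips X r \<subseteq> rips X s" if "r \<le> s"
      using that by (auto simp: rips_def)
    show "(+) v ` \<sigma> \<in> rips UNIV r" if "\<sigma> \<in> rips UNIV r"
      using that by (auto simp: iff split: if_splits)
    show "(*\<^sub>R) t ` \<sigma> \<in> rips UNIV (t * r)" if "\<sigma> \<in> rips UNIV r" "t > 0"
      using that by (auto simp: iff dist_scaleR split: if_splits)
    show "dist x y \<le> 2 * r" if "\<sigma> \<in> rips UNIV r" "x \<in> \<sigma>" "y \<in> \<sigma>"
    proof -
      have "dist x y \<le> r" using that by (auto simp: iff split: if_splits)
      then show ?thesis using zero_le_dist[of x y] by linarith
    qed
    show "{x \<in> space (\<Pi>\<^sub>M i\<in>I. borel). x ` I \<in> rips UNIV r} \<in> sets (\<Pi>\<^sub>M (i::nat)\<in>I. (borel :: 'a measure))"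
      if "finite I" "I \<noteq> {}"
    proof -
      have "{x \<in> space (\<Pi>\<^sub>M i\<in>I. (borel :: 'a measure)). x ` I \<in> rips UNIV r}
          = {x \<in> space (\<Pi>\<^sub>M i\<in>I. borel). \<forall>i\<in>I. \<forall>j\<in>I. dist (x i) (x j) \<le> r}"
        using that by (auto simp: iff)
      also have "\<dots> \<in> sets (\<Pi>\<^sub>M (i::nat)\<in>I. (borel :: 'a measure))"
        using that by measurable
      finally show ?thesis .
    qed
  qed
qed

section \<open>Product Lebesgue measure under affine maps and bounded densities\<close>

lemma PiM_lborel_affine:
  fixes t :: real and v :: "'a::euclidean_space"
  assumes "finite J" "t \<noteq> 0"
  shows "(\<Pi>\<^sub>M i\<in>J. lborel) = density
    (distr (\<Pi>\<^sub>M i\<in>J. lborel) (\<Pi>\<^sub>M i\<in>J. lborel) (\<lambda>x. \<lambda>i\<in>J. v + t *\<^sub>R x i))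
    (\<lambda>_. ennreal (\<bar>t\<bar> ^ (DIM('a) * card J)))"
    (is "?M = density (distr ?M ?M ?T) _")
proof -
  interpret product_sigma_finite "\<lambda>_::'b. lborel :: 'a measure"
    by standard
  have T [measurable]: "?T \<in> measurable ?M ?M"
    by measurable
  show ?thesis
  proof (rule sym, rule PiM_eqI[OF assms(1)])
    fix A :: "'b \<Rightarrow> 'a set" assume A: "\<And>i. i \<in> J \<Longrightarrow> A i \<in> sets lborel"
    have vim: "?T -` Pi\<^sub>E J A \<inter> space ?M = Pi\<^sub>E J (\<lambda>i. (\<lambda>x. v + t *\<^sub>R x) -` A i)"
      by (auto simp: space_PiM PiE_iff extensional_def)
    have PiA: "Pi\<^sub>E J A \<in> sets ?M"
      using A assms(1) by (intro sets_PiM_I_finite) auto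
    have pre: "(\<lambda>x. v + t *\<^sub>R x) -` A i \<in> sets borel" if "i \<in> J" for i
      using A[OF that] measurable_sets[of "\<lambda>x::'a. v + t *\<^sub>R x" borel borel "A i"] by simp
    have comp: "emeasure lborel (A i) = ennreal (\<bar>t\<bar> ^ DIM('a)) * emeasure lborel ((\<lambda>x. v + t *\<^sub>R x) -` A i)"
      if "i \<in> J" for i
      using A[OF that] by (subst lborel_affine[OF assms(2), of v])
        (simp add: emeasure_density nn_integral_cmult_indicator emeasure_distr)
    have "emeasure (density (distr ?M ?M ?T) (\<lambda>_. ennreal (\<bar>t\<bar> ^ (DIM('a) * card J)))) (Pi\<^sub>E J A)
        = ennreal (\<bar>t\<bar> ^ (DIM('a) * card J)) * emeasure ?M (Pi\<^sub>E J (\<lambda>i. (\<lambda>x. v + t *\<^sub>R x) -` A i))"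
      using PiA by (simp add: emeasure_density nn_integral_cmult_indicator emeasure_distr vim)
    also have "\<dots> = (\<Prod>i\<in>J. ennreal (\<bar>t\<bar> ^ DIM('a))) * (\<Prod>i\<in>J. emeasure lborel ((\<lambda>x. v + t *\<^sub>R x) -` A i))"
      using pre assms(1) by (subst emeasure_PiM) (auto simp: power_mult ennreal_power)
    also have "\<dots> = (\<Prod>i\<in>J. emeasure lborel (A i))"
      unfolding prod.distrib[symmetric] by (intro prod.cong) (auto simp: comp)
    finally show "emeasure (density (distr ?M ?M ?T) (\<lambda>_. ennreal (\<bar>t\<bar> ^ (DIM('a) * card J)))) (Pi\<^sub>E J A)
        = (\<Prod>i\<in>J. emeasure lborel (A i))" .
  qed simp
qed

text \<open>Needed in two instances: a pure dilation (\<open>v = 0\<close>) for the homogeneity of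
  volumes, and a pure translation (\<open>t = 1\<close>) for moving a vertex to the origin.\<close>

lemma emeasure_PiM_lborel_affine:
  fixes t :: real and v :: "'a::euclidean_space"
  assumes "finite J" "t \<noteq> 0" "A \<in> sets (\<Pi>\<^sub>M i\<in>J. lborel)"
  shows "emeasure (\<Pi>\<^sub>M i\<in>J. lborel) A = ennreal (\<bar>t\<bar> ^ (DIM('a) * card J)) *
    emeasure (\<Pi>\<^sub>M i\<in>J. lborel) {x \<in> space (\<Pi>\<^sub>M i\<in>J. lborel). (\<lambda>i\<in>J. v + t *\<^sub>R x i) \<in> A}"
proof -
  have "{x \<in> space (\<Pi>\<^sub>M i\<in>J. lborel). (\<lambda>i\<in>J. v + t *\<^sub>R x i) \<in> A}
      = (\<lambda>x. \<lambda>i\<in>J. v + t *\<^sub>R x i) -` A \<inter> space (\<Pi>\<^sub>M i\<in>J. lborel)" by auto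
  then show ?thesis
    using assms(3)
    by (subst PiM_lborel_affine[OF assms(1,2), of v])
      (simp add: emeasure_density nn_integral_cmult_indicator emeasure_distr)
qed

text \<open>Each coordinate measure is dominated by \<open>B\<close> times Lebesgue measure;
  integrating out one coordinate after the other collects one factor \<open>B\<close> for
  each.\<close>

lemma nn_integral_PiM_density_le:
  fixes f :: "'a::euclidean_space \<Rightarrow> real"
  assumes "finite J" and f: "f \<in> borel_measurable borel" "\<And>x. f x \<le> B"
    and D: "D = density lborel (\<lambda>x. ennreal (f x))" "prob_space D"
    and g: "g \<in> borel_measurable (\<Pi>\<^sub>M i\<in>J. borel)"
  shows "(\<integral>\<^sup>+x. g x \<partial>(\<Pi>\<^sub>M i\<in>J. D)) \<le> ennreal B ^ card J * (\<integral>\<^sup>+x. g x \<partial>(\<Pi>\<^sub>M i\<in>J. lborel))"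
  using assms(1) g
proof (induction J arbitrary: g rule: finite_induct)
  case empty
  then show ?case by (simp add: PiM_empty)
next
  case (insert i J)
  interpret L: product_sigma_finite "\<lambda>_::'b. lborel :: 'a measure"
    by standard
  interpret D: prob_space D by (rule D(2))
  interpret D: product_sigma_finite "\<lambda>_::'b. D"
    by standard
  have sD [measurable_cong, simp]: "sets D = sets borel" by (simp add: D(1))
  have [measurable]: "g \<in> borel_measurable (\<Pi>\<^sub>M i\<in>insert i J. borel)"
    by (rule insert.prems)
  have gD: "g \<in> borel_measurable (\<Pi>\<^sub>M i\<in>insert i J. D)" "g \<in> borel_measurable (\<Pi>\<^sub>M i\<in>insert i J. lborel)"
    using insert.prems by (simp_all cong: measurable_cong_sets sets_PiM_cong)
  have step: "(\<integral>\<^sup>+y. g (x(i := y)) \<partial>D) \<le> ennreal B * (\<integral>\<^sup>+y. g (x(i := y)) \<partial>lborel)"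
    if x: "x \<in> space (\<Pi>\<^sub>M i\<in>J. borel)" for x
  proof -
    have [measurable]: "(\<lambda>y. g (x(i := y))) \<in> borel_measurable borel"
      by (rule measurable_compose[OF _ insert.prems]) (use x in measurable)
    have "(\<integral>\<^sup>+y. g (x(i := y)) \<partial>D) = (\<integral>\<^sup>+y. ennreal (f y) * g (x(i := y)) \<partial>lborel)"
      using f(1) unfolding D(1) by (subst nn_integral_density) auto
    also have "\<dots> \<le> (\<integral>\<^sup>+y. ennreal B * g (x(i := y)) \<partial>lborel)"
      by (intro nn_integral_mono mult_right_mono ennreal_leI f(2)) auto
    also have "\<dots> = ennreal B * (\<integral>\<^sup>+y. g (x(i := y)) \<partial>lborel)"
      by (intro nn_integral_cmult) auto
    finally show ?thesis .
  qed
  have meas: "(\<lambda>x. \<integral>\<^sup>+y. g (x(i := y)) \<partial>lborel) \<in> borel_measurable (\<Pi>\<^sub>M i\<in>J. borel)"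
    by measurable
  have meas': "(\<lambda>x. \<integral>\<^sup>+y. g (x(i := y)) \<partial>lborel) \<in> borel_measurable (\<Pi>\<^sub>M i\<in>J. lborel)"
    by measurable
  have "(\<integral>\<^sup>+x. g x \<partial>(\<Pi>\<^sub>M i\<in>insert i J. D)) = (\<integral>\<^sup>+x. \<integral>\<^sup>+y. g (x(i := y)) \<partial>D \<partial>(\<Pi>\<^sub>M i\<in>J. D))"
    by (rule D.product_nn_integral_insert[OF insert.hyps gD(1)])
  also have "\<dots> \<le> (\<integral>\<^sup>+x. ennreal B * (\<integral>\<^sup>+y. g (x(i := y)) \<partial>lborel) \<partial>(\<Pi>\<^sub>M i\<in>J. D))"
    by (intro nn_integral_mono step) (simp add: space_PiM D(1))
  also have "\<dots> \<le> ennreal B ^ card J * (\<integral>\<^sup>+x. ennreal B * (\<integral>\<^sup>+y. g (x(i := y)) \<partial>lborel) \<partial>(\<Pi>\<^sub>M i\<in>J. lborel))"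
    by (rule insert.IH) measurable
  also have "\<dots> = ennreal B ^ card J * (ennreal B * (\<integral>\<^sup>+x. \<integral>\<^sup>+y. g (x(i := y)) \<partial>lborel \<partial>(\<Pi>\<^sub>M i\<in>J. lborel)))"
    by (subst nn_integral_cmult) (rule meas', rule refl)
  also have "\<dots> = ennreal B ^ card (insert i J) * (\<integral>\<^sup>+x. g x \<partial>(\<Pi>\<^sub>M i\<in>insert i J. lborel))"
    using insert.hyps by (simp add: L.product_nn_integral_insert[OF insert.hyps gD(2)] mult.assoc[symmetric] mult.commute)
  finally show ?case .
qed

section \<open>Volumes of configurations that form a simplex\<close>

context homogeneous_filtration
begin

lemma simplex_scale_iff:
  assumes "t > 0" shows "(*\<^sub>R) t ` \<sigma> \<in> K UNIV (t * r) \<longleftrightarrow> \<sigma> \<in> K UNIV r"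
proof
  assume "(*\<^sub>R) t ` \<sigma> \<in> K UNIV (t * r)"
  from simplex_scale[OF this, of "1 / t"] show "\<sigma> \<in> K UNIV r"
    using assms by (simp add: image_image)
qed (use simplex_scale assms in blast)

lemma simplex_translate_iff: "(+) v ` \<sigma> \<in> K UNIV r \<longleftrightarrow> \<sigma> \<in> K UNIV r"
proof
  assume "(+) v ` \<sigma> \<in> K UNIV r"
  from simplex_translate[OF this, of "- v"] show "\<sigma> \<in> K UNIV r"
    by (simp add: image_image)
qed (rule simplex_translate)

text \<open>By translation invariance one vertex can be put at the origin.  The volume of the remaining
  configurations is homogeneous in \<open>r\<close>, hence absolutely continuous as a function of \<open>r\<close>, whatever
  the precise shape of the filtration.\<close>

definition link :: "nat set \<Rightarrow> real \<Rightarrow> (nat \<Rightarrow> 'a) set" where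
  "link J r = {y \<in> space (\<Pi>\<^sub>M i\<in>J. lborel). insert 0 (y ` J) \<in> K UNIV r}"

lemma image_fun_upd_insert: "i \<notin> J \<Longrightarrow> (y(i := v)) ` insert i J = insert v (y ` J)"
  by (auto simp: image_iff)

lemma sets_link:
  assumes "finite J" shows "link J r \<in> sets (\<Pi>\<^sub>M i\<in>J. lborel)"
proof -
  \<comment> \<open>\<open>simplex_measurable\<close> speaks of simplices all of whose vertices are
    indexed; the fresh index \<open>i\<close> carries the origin.\<close>
  obtain i where i: "i \<notin> J" using assms ex_new_if_finite infinite_UNIV_nat by blast
  let ?U = "{x \<in> space (\<Pi>\<^sub>M i\<in>insert i J. borel). x ` insert i J \<in> K UNIV r}"
  have "(\<lambda>y. y(i := 0)) \<in> measurable (\<Pi>\<^sub>M i\<in>J. borel) (\<Pi>\<^sub>M i\<in>insert i J. (borel :: 'a measure))"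
    by measurable
  from measurable_sets[OF this simplex_measurable[of "insert i J" r]]
  have "(\<lambda>y. y(i := 0)) -` ?U \<inter> space (\<Pi>\<^sub>M i\<in>J. borel) \<in> sets (\<Pi>\<^sub>M i\<in>J. (borel :: 'a measure))"
    using assms by auto
  also have "(\<lambda>y. y(i := 0)) -` ?U \<inter> space (\<Pi>\<^sub>M i\<in>J. borel) = link J r"
  proof -
    have "y(i := 0) \<in> space (\<Pi>\<^sub>M i\<in>insert i J. borel)" if "y \<in> space (\<Pi>\<^sub>M i\<in>J. borel)" for y :: "nat \<Rightarrow> 'a"
      using that by (auto simp: space_PiM PiE_iff extensional_def)
    then show ?thesis
      unfolding link_def vimage_def mem_Collect_eq image_fun_upd_insert[OF i] by (auto simp: space_PiM)
  qed
  also have "sets (\<Pi>\<^sub>M i\<in>J. (borel :: 'a measure)) = sets (\<Pi>\<^sub>M i\<in>J. lborel)"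
    by (intro sets_PiM_cong) auto
  finally show ?thesis .
qed

lemma link_mono: "r \<le> s \<Longrightarrow> link J r \<subseteq> link J s"
  using simplex_mono[of r s UNIV] by (auto simp: link_def)

lemma link_subset_cball: "link J r \<subseteq> Pi\<^sub>E J (\<lambda>_. cball 0 (2 * r))"
proof
  fix y assume y: "y \<in> link J r"
  then have "dist 0 (y i) \<le> 2 * r" if "i \<in> J" for i
    using that by (intro simplex_dist[of "insert 0 (y ` J)"]) (auto simp: link_def)
  then show "y \<in> Pi\<^sub>E J (\<lambda>_. cball 0 (2 * r))"
    using y by (auto simp: link_def space_PiM PiE_iff)
qed

lemma emeasure_link_1_le:
  assumes "finite J"
  shows "emeasure (\<Pi>\<^sub>M i\<in>J. lborel) (link J 1) \<le> ennreal (measure lborel (cball (0 :: 'a) 2) ^ card J)"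
proof -
  interpret product_sigma_finite "\<lambda>_::nat. lborel :: 'a measure"
    by standard
  have "emeasure (\<Pi>\<^sub>M i\<in>J. lborel) (link J 1)
      \<le> emeasure (\<Pi>\<^sub>M i\<in>J. (lborel :: 'a measure)) (Pi\<^sub>E J (\<lambda>_. cball 0 2))"
    using link_subset_cball[of J 1] assms by (intro emeasure_mono sets_PiM_I_finite) auto
  also have "\<dots> = emeasure lborel (cball (0::'a) 2) ^ card J"
    using assms by (subst emeasure_PiM) auto
  also have "\<dots> = ennreal (measure lborel (cball (0 :: 'a) 2) ^ card J)"
    using emeasure_lborel_cball_finite[of "0::'a" 2]
    by (simp add: emeasure_eq_ennreal_measure ennreal_power top.not_eq_extremum)
  finally show ?thesis .
qed

text \<open>For \<open>r > 0\<close>, dilation by \<open>r\<close> carries \<open>link J 1\<close>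
  to \<open>link J r\<close>. For \<open>r \<le> 0\<close> the link contains at most the constant
  configuration 0 (it does contain it for Rips at \<open>r = 0\<close>), which is a null set as
  \<open>J\<close> is nonempty; the maximum with 0 encodes this case.\<close>

lemma emeasure_link:
  assumes "finite J" "J \<noteq> {}"
  shows "emeasure (\<Pi>\<^sub>M i\<in>J. lborel) (link J r)
    = ennreal (max 0 r ^ (DIM('a) * card J)) * emeasure (\<Pi>\<^sub>M i\<in>J. lborel) (link J 1)"
proof (cases "r > 0")
  case True
  have "{x \<in> space (\<Pi>\<^sub>M i\<in>J. lborel). (\<lambda>i\<in>J. 0 + r *\<^sub>R x i) \<in> link J r} = link J 1"
  proof -
    have "insert 0 ((\<lambda>i\<in>J. 0 + r *\<^sub>R x i) ` J) = (*\<^sub>R) r ` insert 0 (x ` J)" for x :: "nat \<Rightarrow> 'a"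
      by (auto simp: image_image)
    then have "insert 0 ((\<lambda>i\<in>J. 0 + r *\<^sub>R x i) ` J) \<in> K UNIV r \<longleftrightarrow> insert 0 (x ` J) \<in> K UNIV 1" for x :: "nat \<Rightarrow> 'a"
      using simplex_scale_iff[OF True, of "insert 0 (x ` J)" 1] by (simp only: mult_1_right)
    moreover have "(\<lambda>i\<in>J. 0 + r *\<^sub>R x i) \<in> space (\<Pi>\<^sub>M i\<in>J. lborel)" for x :: "nat \<Rightarrow> 'a"
      by (simp add: space_PiM)
    ultimately show ?thesis
      unfolding link_def mem_Collect_eq by (simp only: simp_thms)
  qed
  then show ?thesis
    using emeasure_PiM_lborel_affine[OF assms(1) _ sets_link[OF assms(1)], of r r 0] True by simp
next
  case False
  interpret product_sigma_finite "\<lambda>_::nat. lborel :: 'a measure"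
    by standard
  have "emeasure (\<Pi>\<^sub>M i\<in>J. lborel) (link J r)
      \<le> emeasure (\<Pi>\<^sub>M i\<in>J. (lborel :: 'a measure)) (Pi\<^sub>E J (\<lambda>_. {0}))"
  proof (intro emeasure_mono sets_PiM_I_finite)
    have "cball (0::'a) (2 * r) \<subseteq> cball 0 0" using False by (intro subset_cball) simp
    then have "cball (0::'a) (2 * r) \<subseteq> {0}" by simp
    then show "link J r \<subseteq> Pi\<^sub>E J (\<lambda>_. {0})"
      using link_subset_cball[of J r] PiE_mono[of J "\<lambda>_. cball (0::'a) (2 * r)" "\<lambda>_. {0}"] by blast
  qed (use assms in auto)
  also have "\<dots> = 0"
    using assms by (subst emeasure_PiM) auto
  finally show ?thesis
    using False assms by (simp add: max_def card_gt_0_iff power_0_left)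
qed

text \<open>The volumes at \<open>a\<close> and at \<open>b\<close> are multiples of powers with the
  same factor \<open>c\<close>, the volume of \<open>link J 1\<close>. So any upper bound on
  \<open>c\<close> yields a bound proportional to the increment of the power. Here it is the volume
  of a ball of radius 2 for each vertex.\<close>

lemma emeasure_link_diff_le:
  assumes "finite J" "J \<noteq> {}" "a \<le> b"
  shows "emeasure (\<Pi>\<^sub>M i\<in>J. lborel) (link J b - link J a)
    \<le> ennreal (measure lborel (cball (0 :: 'a) 2) ^ card J * (max 0 b ^ (DIM('a) * card J) - max 0 a ^ (DIM('a) * card J)))"
proof -
  let ?e = "emeasure (\<Pi>\<^sub>M i\<in>J. lborel)" and ?p = "\<lambda>r. max 0 r ^ (DIM('a) * card J) :: real"
  define c where "c = enn2real (?e (link J 1))"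
  have "?e (link J 1) < top"
    using emeasure_link_1_le[OF assms(1)] ennreal_less_top by (rule le_less_trans)
  then have c: "?e (link J 1) = ennreal c" "0 \<le> c"
    unfolding c_def by simp_all
  have c_le: "c \<le> measure lborel (cball (0 :: 'a) 2) ^ card J"
    unfolding c_def using emeasure_link_1_le[OF assms(1)] by (intro enn2real_leI) auto
  have e: "?e (link J r) = ennreal (?p r * c)" for r
    using emeasure_link[OF assms(1,2)] c by (simp add: ennreal_mult)
  have p: "?p a \<le> ?p b" using assms(3) by (intro power_mono) auto
  have "?e (link J b - link J a) = ?e (link J b) - ?e (link J a)"
    using sets_link[OF assms(1)] link_mono[OF assms(3)] by (intro emeasure_Diff) (auto simp: e)
  also have "\<dots> = ennreal (c * (?p b - ?p a))"
    using p c(2) by (simp add: e ennreal_minus algebra_simps)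
  also have "\<dots> \<le> ennreal (measure lborel (cball (0 :: 'a) 2) ^ card J * (?p b - ?p a))"
    using p c_le by (intro ennreal_leI mult_right_mono) auto
  finally show ?thesis .
qed

lemma sets_entering:
  assumes "finite I" "I \<noteq> {}"
  shows "{x \<in> space (\<Pi>\<^sub>M i\<in>I. borel). x ` I \<in> K UNIV b - K UNIV a} \<in> sets (\<Pi>\<^sub>M (i::nat)\<in>I. borel)"
proof -
  have eq: "{x \<in> space (\<Pi>\<^sub>M i\<in>I. borel). x ` I \<in> K UNIV b - K UNIV a}
      = {x \<in> space (\<Pi>\<^sub>M i\<in>I. borel). x ` I \<in> K UNIV b} - {x \<in> space (\<Pi>\<^sub>M i\<in>I. borel). x ` I \<in> K UNIV a}"
    by auto
  show ?thesis
    unfolding eq by (intro sets.Diff simplex_measurable assms)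
qed

text \<open>One vertex \<open>v\<close> is held fixed and translated to the origin, and the other
  \<open>k\<close> vertices are integrated over the link. The resulting bound does not depend on
  \<open>v\<close>, and \<open>D\<close> has mass 1, so the fixed vertex costs nothing: the exponent
  of \<open>B\<close> is \<open>k\<close>, not \<open>k + 1\<close>.\<close>

lemma emeasure_PiM_density_entering_le:
  fixes f :: "'a \<Rightarrow> real" and I :: "nat set"
  assumes f: "f \<in> borel_measurable borel" "\<And>x. f x \<le> B"
    and D: "D = density lborel (\<lambda>x. ennreal (f x))" "prob_space D"
    and I: "finite I" "card I = Suc k" "k > 0" and "a \<le> b"
  shows "emeasure (\<Pi>\<^sub>M i\<in>I. D) {x \<in> space (\<Pi>\<^sub>M i\<in>I. borel). x ` I \<in> K UNIV b - K UNIV a}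
    \<le> ennreal B ^ k * ennreal (measure lborel (cball (0 :: 'a) 2) ^ k * (max 0 b ^ (DIM('a) * k) - max 0 a ^ (DIM('a) * k)))"
    (is "emeasure _ ?U \<le> ?R")
proof -
  obtain i where "i \<in> I" using I by fastforce
  define J where "J = I - {i}"
  have J: "finite J" "i \<notin> J" "card J = k" and IJ: "I = insert i J"
    using \<open>i \<in> I\<close> I by (auto simp: J_def)
  have "J \<noteq> {}" using J(3) I(3) by auto
  interpret D: prob_space D by (rule D(2))
  interpret D: product_sigma_finite "\<lambda>_::nat. D"
    by standard
  have sD [measurable_cong, simp]: "sets D = sets borel" by (simp add: D(1))
  have U [measurable]: "?U \<in> sets (\<Pi>\<^sub>M i\<in>insert i J. borel)"
    using sets_entering[of I b a] I(1) \<open>i \<in> I\<close> unfolding IJ by auto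
  then have UD: "?U \<in> sets (\<Pi>\<^sub>M i\<in>insert i J. D)"
    by (simp cong: sets_PiM_cong)
  have slice: "(\<integral>\<^sup>+x. indicator ?U (x(i := v)) \<partial>(\<Pi>\<^sub>M i\<in>J. D)) \<le> ?R" for v
  proof -
    have "(\<integral>\<^sup>+x. indicator ?U (x(i := v)) \<partial>(\<Pi>\<^sub>M i\<in>J. D))
        \<le> ennreal B ^ card J * (\<integral>\<^sup>+x. indicator ?U (x(i := v)) \<partial>(\<Pi>\<^sub>M i\<in>J. lborel))"
      by (rule nn_integral_PiM_density_le[OF J(1) f D]) measurable
    also have "(\<integral>\<^sup>+x. indicator ?U (x(i := v)) \<partial>(\<Pi>\<^sub>M i\<in>J. (lborel :: 'a measure)))
        = (\<integral>\<^sup>+x. indicator {x \<in> space (\<Pi>\<^sub>M i\<in>J. lborel). (\<lambda>i\<in>J. - v + 1 *\<^sub>R x i) \<in> link J b - link J a} x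
            \<partial>(\<Pi>\<^sub>M i\<in>J. lborel))"
    proof (intro nn_integral_cong)
      fix x :: "nat \<Rightarrow> 'a" assume x: "x \<in> space (\<Pi>\<^sub>M i\<in>J. lborel)"
      define \<sigma> where "\<sigma> = insert v (x ` J)"
      have "insert 0 ((\<lambda>i\<in>J. - v + 1 *\<^sub>R x i) ` J) = (+) (- v) ` \<sigma>"
        by (auto simp: \<sigma>_def image_image)
      moreover have "(x(i := v)) ` insert i J = \<sigma>"
        unfolding \<sigma>_def by (rule image_fun_upd_insert[OF J(2)])
      moreover have "x(i := v) \<in> space (\<Pi>\<^sub>M i\<in>insert i J. borel)"
        "(\<lambda>i\<in>J. - v + 1 *\<^sub>R x i) \<in> space (\<Pi>\<^sub>M i\<in>J. lborel)"
        using x by (auto simp: space_PiM PiE_iff extensional_def)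
      ultimately have "x(i := v) \<in> ?U \<longleftrightarrow> (\<lambda>i\<in>J. - v + 1 *\<^sub>R x i) \<in> link J b - link J a"
        unfolding IJ by (simp only: link_def simplex_translate_iff Diff_iff mem_Collect_eq simp_thms)
      then show "indicator ?U (x(i := v)) = (indicator {x \<in> space (\<Pi>\<^sub>M i\<in>J. lborel).
          (\<lambda>i\<in>J. - v + 1 *\<^sub>R x i) \<in> link J b - link J a} x :: ennreal)"
        using x by (simp add: indicator_def)
    qed
    also have "\<dots> = emeasure (\<Pi>\<^sub>M i\<in>J. lborel) {x \<in> space (\<Pi>\<^sub>M i\<in>J. lborel).
        (\<lambda>i\<in>J. - v + 1 *\<^sub>R x i) \<in> link J b - link J a}"
    proof (rule nn_integral_indicator)
      have "(\<lambda>x. \<lambda>i\<in>J. - v + 1 *\<^sub>R x i) \<in> measurable (\<Pi>\<^sub>M i\<in>J. lborel) (\<Pi>\<^sub>M i\<in>J. (lborel :: 'a measure))"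
        by measurable
      from measurable_sets[OF this sets.Diff[OF sets_link[OF J(1)] sets_link[OF J(1)], of b a]]
      show "{x \<in> space (\<Pi>\<^sub>M i\<in>J. lborel). (\<lambda>i\<in>J. - v + 1 *\<^sub>R x i) \<in> link J b - link J a} \<in> sets (\<Pi>\<^sub>M i\<in>J. lborel)"
        by (simp add: vimage_def Int_def conj_commute)
    qed
    also have "\<dots> = emeasure (\<Pi>\<^sub>M i\<in>J. lborel) (link J b - link J a)"
      using emeasure_PiM_lborel_affine[OF J(1) _ sets.Diff[OF sets_link[OF J(1)] sets_link[OF J(1)]], of 1 b a "- v"]
      by simp
    also have "ennreal B ^ card J * emeasure (\<Pi>\<^sub>M i\<in>J. lborel) (link J b - link J a) \<le> ?R"
      using emeasure_link_diff_le[OF J(1) \<open>J \<noteq> {}\<close> \<open>a \<le> b\<close>] unfolding J(3) by (intro mult_left_mono) auto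
    finally show ?thesis .
  qed
  have "emeasure (\<Pi>\<^sub>M i\<in>I. D) ?U = (\<integral>\<^sup>+x. indicator ?U x \<partial>(\<Pi>\<^sub>M i\<in>insert i J. D))"
    using UD by (simp add: IJ)
  also have "\<dots> = (\<integral>\<^sup>+v. \<integral>\<^sup>+x. indicator ?U (x(i := v)) \<partial>(\<Pi>\<^sub>M i\<in>J. D) \<partial>D)"
    using UD by (intro D.product_nn_integral_insert_rev J(1,2)) simp
  also have "\<dots> \<le> (\<integral>\<^sup>+v. ?R \<partial>D)"
    by (intro nn_integral_mono slice)
  also have "\<dots> = ?R"
    by (simp add: D.emeasure_space_1)
  finally show ?thesis .
qed

end

section \<open>Random samples\<close>

lemma sets_R2gt_strip:
  assumes "\<pi> = fst \<or> \<pi> = snd"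
  shows "{r \<in> R2gt. a < \<pi> r \<and> \<pi> r < b} \<in> sets (restrict_space borel R2gt)"
proof -
  have R: "R2gt \<in> sets borel"
    unfolding R2gt_def by (intro borel_open open_Collect_less continuous_intros)
  have [measurable]: "\<pi> \<in> borel_measurable (borel :: (real \<times> real) measure)"
    using assms measurable_fst[of borel borel] measurable_snd[of borel borel]
    unfolding borel_prod[symmetric] by blast
  have "{r :: real \<times> real. a < \<pi> r \<and> \<pi> r < b} \<in> sets borel"
    by measurable
  then have "R2gt \<inter> {r. a < \<pi> r \<and> \<pi> r < b} \<in> sets borel"
    using R by blast
  moreover have "{r \<in> R2gt. a < \<pi> r \<and> \<pi> r < b} = R2gt \<inter> {r. a < \<pi> r \<and> \<pi> r < b}"
    by auto
  ultimately show ?thesis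
    using R by (simp add: sets_restrict_space_iff)
qed

context homogeneous_filtration
begin

lemma finite_filtration: "finite S \<Longrightarrow> finite_filtration S (K S)"
  using simplex_mono simplex_iff[of _ S] by unfold_locales auto

text \<open>A birth in degree \<open>q\<close> is caused by a \<open>q\<close>-simplex, a death by a \<open>(q + 1)\<close>-simplex: hence the
  two values of \<open>k\<close>.\<close>

lemma emeasure_diagram_strip_le:
  assumes "finite S" "a \<le> b" and \<pi>: "\<pi> = fst \<and> k = q \<or> \<pi> = snd \<and> k = Suc q"
  shows "emeasure (diagram_measure (dgm (K S) q)) {r \<in> R2gt. a < \<pi> r \<and> \<pi> r < b}
    \<le> of_nat (card {\<sigma> \<in> K S b - K S a. card \<sigma> = Suc k})"
proof -
  interpret finite_filtration S "K S" by (rule finite_filtration) fact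
  show ?thesis
  proof (rule emeasure_diagram_measure_le)
    show "{r \<in> R2gt. a < \<pi> r \<and> \<pi> r < b} \<in> sets (restrict_space borel R2gt)"
      using \<pi> by (intro sets_R2gt_strip) auto
    fix T assume T: "finite T" "T \<subseteq> {r \<in> R2gt. a < \<pi> r \<and> \<pi> r < b}"
    show "(\<Sum>r\<in>T. dgm (K S) q r) \<le> card {\<sigma> \<in> K S b - K S a. card \<sigma> = Suc k}"
      using \<pi>
    proof
      assume "\<pi> = fst \<and> k = q"
      with T show ?thesis
        using \<open>a \<le> b\<close> dgm_sum_birth_in_le[of T a b q] by blast
    next
      assume "\<pi> = snd \<and> k = Suc q"
      with T show ?thesis
        using \<open>a \<le> b\<close> dgm_sum_death_in_le[of T a b q] by blast
    qed
  qed
qed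

text \<open>Sample points may coincide, so index sets are counted instead of simplices: every
  simplex is the image of an index set of its own size on which \<open>y\<close> is
  injective.\<close>

lemma card_simplices_image_le:
  assumes "finite J"
  shows "card {\<sigma> \<in> K (y ` J) b - K (y ` J) a. card \<sigma> = m}
    \<le> card {I \<in> Pow J. card I = m \<and> y ` I \<in> K UNIV b - K UNIV a}"
proof -
  have "{\<sigma> \<in> K (y ` J) b - K (y ` J) a. card \<sigma> = m}
      \<subseteq> (\<lambda>I. y ` I) ` {I \<in> Pow J. card I = m \<and> y ` I \<in> K UNIV b - K UNIV a}"
  proof
    fix \<sigma> assume \<sigma>: "\<sigma> \<in> {\<sigma> \<in> K (y ` J) b - K (y ` J) a. card \<sigma> = m}"
    then have "\<sigma> \<subseteq> y ` J" "\<sigma> \<in> K UNIV b - K UNIV a" "card \<sigma> = m"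
      using simplex_iff[of \<sigma> "y ` J"] by auto
    moreover from this(1) obtain I where "I \<subseteq> J" "inj_on y I" "\<sigma> = y ` I"
      unfolding subset_image_inj by blast
    ultimately show "\<sigma> \<in> (\<lambda>I. y ` I) ` {I \<in> Pow J. card I = m \<and> y ` I \<in> K UNIV b - K UNIV a}"
      by (auto simp: card_image)
  qed
  then show ?thesis
    using assms by (intro surj_card_le) auto
qed

lemma scaled_simplex_iff:
  assumes "c > 0"
  shows "(\<lambda>i. c *\<^sub>R y i) ` I \<in> K UNIV b \<longleftrightarrow> y ` I \<in> K UNIV (b / c)"
  using simplex_scale_iff[OF assms, of "y ` I" "b / c"] assms by (simp add: image_image)

end

section \<open>Expected counts over a random number of points\<close>

context prob_space
begin

text \<open>A Wald-type estimate: given \<open>S = j\<close> there are \<open>j choose m\<close>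
  index sets, and the event of each is independent of \<open>S = j\<close> and has probability at
  most \<open>p\<close>. Summing over \<open>j\<close> reassembles the binomial moment of
  \<open>S\<close>.\<close>

lemma expected_number_of_events_le:
  fixes S :: "'a \<Rightarrow> nat" and A :: "nat set \<Rightarrow> 'a set"
  assumes S: "S \<in> measurable M (count_space UNIV)"
    and A: "\<And>I. finite I \<Longrightarrow> I \<subseteq> {1..} \<Longrightarrow> card I = m \<Longrightarrow> A I \<in> events \<and> emeasure M (A I) \<le> p"
    and indep: "\<And>I j. finite I \<Longrightarrow> I \<subseteq> {1..} \<Longrightarrow> card I = m \<Longrightarrow>
      prob (A I \<inter> (S -` {j} \<inter> space M)) = prob (A I) * prob (S -` {j} \<inter> space M)"
  shows "(\<integral>\<^sup>+\<omega>. of_nat (card {I \<in> Pow {1..S \<omega>}. card I = m \<and> \<omega> \<in> A I}) \<partial>M)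
    \<le> p * (\<integral>\<^sup>+\<omega>. of_nat (S \<omega> choose m) \<partial>M)"
proof -
  define J where "J j = {I \<in> Pow {1..j}. card I = m}" for j :: nat
  define E where "E j = S -` {j} \<inter> space M" for j
  have J: "finite I" "I \<subseteq> {1..}" "card I = m" if "I \<in> J j" for I j
    using that finite_subset[of I "{1..j}"] by (auto simp: J_def)
  have finJ: "finite (J j)" for j
    by (auto simp: J_def)
  have cardJ: "card (J j) = j choose m" for j
    using n_subsets[of "{1..j}" m] by (simp add: J_def)
  have E [measurable]: "E j \<in> events" for j
    unfolding E_def using measurable_sets[OF S, of "{j}"] by simp
  have disj: "disjoint_family E"
    by (auto simp: E_def disjoint_family_on_def)
  have AI: "A I \<in> events" if "I \<in> J j" for I j
    using A[of I] J[OF that] by blast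
  have meas: "(\<lambda>\<omega>. (\<Sum>I\<in>J j. indicator (A I) \<omega>) * indicator (E j) \<omega> :: ennreal) \<in> borel_measurable M" for j
    by (intro borel_measurable_times_ennreal borel_measurable_sum borel_measurable_indicator AI E)
  have termwise: "(\<integral>\<^sup>+\<omega>. (\<Sum>I\<in>J j. indicator (A I) \<omega>) * indicator (E j) \<omega> \<partial>M)
      \<le> p * (of_nat (j choose m) * emeasure M (E j))" for j
  proof -
    have "(\<integral>\<^sup>+\<omega>. (\<Sum>I\<in>J j. indicator (A I) \<omega>) * indicator (E j) \<omega> \<partial>M)
        = (\<integral>\<^sup>+\<omega>. (\<Sum>I\<in>J j. indicator (A I \<inter> E j) \<omega>) \<partial>M)"
      by (intro nn_integral_cong) (simp add: sum_distrib_right indicator_inter_arith)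
    also have "\<dots> = (\<Sum>I\<in>J j. emeasure M (A I \<inter> E j))"
      using AI E by (subst nn_integral_sum) (auto intro!: sum.cong nn_integral_indicator)
    also have "\<dots> \<le> (\<Sum>I\<in>J j. p * emeasure M (E j))"
    proof (rule sum_mono)
      fix I assume I: "I \<in> J j"
      have "emeasure M (A I \<inter> E j) = emeasure M (A I) * emeasure M (E j)"
        using indep[OF J[OF I], of j] unfolding E_def[symmetric]
        by (simp add: emeasure_eq_measure ennreal_mult)
      also have "\<dots> \<le> p * emeasure M (E j)"
        using A[OF J[OF I]] by (intro mult_right_mono) auto
      finally show "emeasure M (A I \<inter> E j) \<le> p * emeasure M (E j)" .
    qed
    also have "\<dots> = p * (of_nat (j choose m) * emeasure M (E j))"
      by (simp add: cardJ mult_ac)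
    finally show ?thesis .
  qed
  have "(\<integral>\<^sup>+\<omega>. of_nat (card {I \<in> Pow {1..S \<omega>}. card I = m \<and> \<omega> \<in> A I}) \<partial>M)
      = (\<integral>\<^sup>+\<omega>. (\<Sum>j. (\<Sum>I\<in>J j. indicator (A I) \<omega>) * indicator (E j) \<omega>) \<partial>M)"
  proof (rule nn_integral_cong)
    fix \<omega> assume "\<omega> \<in> space M"
    then have "\<omega> \<in> E (S \<omega>)" by (simp add: E_def)
    then have "(\<Sum>j. (\<Sum>I\<in>J j. indicator (A I) \<omega> :: ennreal) * indicator (E j) \<omega>)
        = (\<Sum>I\<in>J (S \<omega>). indicator (A I) \<omega>)"
      by (rule suminf_cmult_indicator[OF disj])
    also have "\<dots> = (\<Sum>I\<in>{I \<in> J (S \<omega>). \<omega> \<in> A I}. 1)"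
      using finJ by (intro sum.mono_neutral_cong_right) auto
    also have "\<dots> = of_nat (card {I \<in> Pow {1..S \<omega>}. card I = m \<and> \<omega> \<in> A I})"
      by (simp add: J_def conj_assoc)
    finally show "of_nat (card {I \<in> Pow {1..S \<omega>}. card I = m \<and> \<omega> \<in> A I})
      = (\<Sum>j. (\<Sum>I\<in>J j. indicator (A I) \<omega> :: ennreal) * indicator (E j) \<omega>)" ..
  qed
  also have "\<dots> = (\<Sum>j. \<integral>\<^sup>+\<omega>. (\<Sum>I\<in>J j. indicator (A I) \<omega>) * indicator (E j) \<omega> \<partial>M)"
    by (rule nn_integral_suminf[OF meas])
  also have "\<dots> \<le> (\<Sum>j. p * (of_nat (j choose m) * emeasure M (E j)))"
    by (intro suminf_le termwise) auto
  also have "\<dots> = p * (\<Sum>j. \<integral>\<^sup>+\<omega>. of_nat (j choose m) * indicator (E j) \<omega> \<partial>M)"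
    by (simp add: nn_integral_cmult_indicator)
  also have "(\<Sum>j. \<integral>\<^sup>+\<omega>. of_nat (j choose m) * indicator (E j) \<omega> \<partial>M)
      = (\<integral>\<^sup>+\<omega>. (\<Sum>j. of_nat (j choose m) * indicator (E j) \<omega>) \<partial>M)"
    by (intro nn_integral_suminf[symmetric]) measurable
  also have "\<dots> = (\<integral>\<^sup>+\<omega>. of_nat (S \<omega> choose m) \<partial>M)"
    by (intro nn_integral_cong suminf_cmult_indicator[OF disj]) (auto simp: E_def)
  finally show ?thesis .
qed

end

text \<open>The factorial moment of order \<open>m\<close> divided by \<open>m!\<close>: the terms
  with \<open>j < m\<close> vanish and the others are a shifted exponential series.\<close>

lemma poisson_binomial_moment:
  fixes \<rho> :: real
  assumes "\<rho> > 0"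
  shows "(\<integral>\<^sup>+j. of_nat (j choose m) \<partial>measure_pmf (poisson_pmf \<rho>)) = ennreal (\<rho> ^ m / fact m)"
proof -
  define g where "g j = \<rho> ^ j / fact j * exp (-\<rho>) * real (j choose m)" for j
  have "(\<lambda>j. \<rho> ^ m / fact m * exp (-\<rho>) * (\<rho> ^ j /\<^sub>R fact j)) sums (\<rho> ^ m / fact m * exp (-\<rho>) * exp \<rho>)"
    by (intro sums_mult exp_converges)
  moreover have "\<rho> ^ m / fact m * exp (-\<rho>) * (\<rho> ^ j /\<^sub>R fact j) = g (j + m)" for j
    by (simp add: g_def binomial_fact power_add field_simps)
  moreover have "\<rho> ^ m / fact m * exp (-\<rho>) * exp \<rho> = \<rho> ^ m / fact m"
    by (simp add: mult.assoc flip: exp_add)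
  ultimately have "(\<lambda>j. g (j + m)) sums (\<rho> ^ m / fact m)"
    by (simp only:)
  moreover have "(\<Sum>j<m. g j) = 0"
    by (intro sum.neutral) (auto simp: g_def)
  ultimately have sums: "g sums (\<rho> ^ m / fact m)"
    using sums_iff_shift[of g m "\<rho> ^ m / fact m"] by simp
  have "(\<integral>\<^sup>+j. of_nat (j choose m) \<partial>measure_pmf (poisson_pmf \<rho>))
      = (\<integral>\<^sup>+j. ennreal (pmf (poisson_pmf \<rho>) j) * of_nat (j choose m) \<partial>count_space UNIV)"
    by (rule nn_integral_measure_pmf)
  also have "\<dots> = (\<Sum>j. ennreal (g j))"
    using assms by (subst nn_integral_count_space_nat)
      (simp add: g_def ennreal_of_nat_eq_real_of_nat mult_ac flip: ennreal_mult'')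
  also have "\<dots> = ennreal (\<rho> ^ m / fact m)"
    using assms by (intro suminf_ennreal_eq[OF _ sums]) (simp add: g_def)
  finally show ?thesis .
qed

definition sample_size :: "scheme \<Rightarrow> (nat \<Rightarrow> 'w \<Rightarrow> nat) \<Rightarrow> nat \<Rightarrow> 'w \<Rightarrow> nat" where
  "sample_size sch N n \<omega> = (case sch of Binomial \<Rightarrow> n | Poissonized \<Rightarrow> N n \<omega>)"

lemma sample_eq: "sample sch X N n \<omega> = (\<lambda>i. X i \<omega>) ` {1..sample_size sch N n \<omega>}"
  by (cases sch) (simp_all add: sample_size_def)

section \<open>Simplices entering in a random sample\<close>

locale random_sample = homogeneous_filtration K + prob_space P
  for K :: "(real ^ 'n) set \<Rightarrow> (real ^ 'n) filtration" and P :: "'w measure" +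
  fixes \<kappa> :: "real ^ 'n \<Rightarrow> real"
    and X :: "nat \<Rightarrow> 'w \<Rightarrow> real ^ 'n"
    and N :: "nat \<Rightarrow> 'w \<Rightarrow> nat"
  assumes density: "bounded_density \<kappa>"
    and samples: "sampling_sequences P \<kappa> X N"
begin

abbreviation entering :: "real \<Rightarrow> real \<Rightarrow> nat set \<Rightarrow> 'w set" where
  "entering a b I \<equiv> {\<omega> \<in> space P. (\<lambda>i. X i \<omega>) ` I \<in> K UNIV b - K UNIV a}"

lemma X_measurable: "i \<ge> 1 \<Longrightarrow> X i \<in> borel_measurable P"
  using samples by (auto simp: sampling_sequences_def distributed_def)

lemma N_measurable: "n \<ge> 1 \<Longrightarrow> N n \<in> measurable P (count_space UNIV)"
  using samples indep_vars_def2[of "\<lambda>_. count_space UNIV" N "{1..}"]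
  by (auto simp: sampling_sequences_def)

text \<open>Independence of the points and the Poisson variables is given for the \<sigma>-algebras
  of the whole sequences, so the event has to be exhibited as a preimage under the whole
  sequence.\<close>

lemma entering_in_sigma:
  assumes "finite I" "I \<noteq> {}" "I \<subseteq> {1..}"
  shows "entering a b I \<in> sets (vimage_algebra (space P) (\<lambda>\<omega>. \<lambda>i\<in>{1..}. X i \<omega>) (\<Pi>\<^sub>M i\<in>{1..}. borel))"
proof -
  let ?U = "{x \<in> space (\<Pi>\<^sub>M i\<in>I. borel). x ` I \<in> K UNIV b - K UNIV a}"
  let ?W = "(\<lambda>x. restrict x I) -` ?U \<inter> space (\<Pi>\<^sub>M (i::nat)\<in>{1..}. (borel :: (real ^ 'n) measure))"
  have "?W \<in> sets (\<Pi>\<^sub>M i\<in>{1..}. borel)"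
    by (rule measurable_sets[OF measurable_restrict_subset[OF assms(3)] sets_entering[OF assms(1,2)]])
  then have "(\<lambda>\<omega>. \<lambda>i\<in>{1..}. X i \<omega>) -` ?W \<inter> space P
      \<in> sets (vimage_algebra (space P) (\<lambda>\<omega>. \<lambda>i\<in>{1..}. X i \<omega>) (\<Pi>\<^sub>M i\<in>{1..}. borel))"
    by (rule in_vimage_algebra)
  also have "(\<lambda>\<omega>. \<lambda>i\<in>{1..}. X i \<omega>) -` ?W \<inter> space P = entering a b I"
  proof -
    have "restrict (\<lambda>i\<in>{1..}. X i \<omega>) I ` I = (\<lambda>i. X i \<omega>) ` I" for \<omega>
      using assms(3) by (intro image_cong) auto
    then show ?thesis by (auto simp: space_PiM)
  qed
  finally show ?thesis .
qed

text \<open>One constant for all index sets and all windows; the uniformity in \<open>n\<close>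
  comes from here.\<close>

lemma entering_prob_le:
  obtains C where "C \<ge> 0" "\<And>I k a b. finite I \<Longrightarrow> I \<subseteq> {1..} \<Longrightarrow> card I = Suc k \<Longrightarrow> k > 0 \<Longrightarrow> a \<le> b \<Longrightarrow>
    entering a b I \<in> events \<and>
    emeasure P (entering a b I) \<le> ennreal (C ^ k * (max 0 b ^ (CARD('n) * k) - max 0 a ^ (CARD('n) * k)))"
proof -
  define f where "f x = \<kappa> x * indicator unit_cube x" for x
  obtain B0 where "\<And>x. x \<in> unit_cube \<Longrightarrow> \<kappa> x \<le> B0"
    using density by (auto simp: bounded_density_def)
  \<comment> \<open>\<open>f\<close> vanishes outside the cube, so its bound must also be
    non-negative.\<close>
  define B where "B = max B0 0"
  have "0 \<le> B" by (simp add: B_def)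
  have f_le: "f x \<le> B" for x
    using \<open>x \<in> unit_cube \<Longrightarrow> \<kappa> x \<le> B0\<close> by (auto simp: f_def B_def indicator_def le_max_iff_disj)
  have f_meas: "f \<in> borel_measurable borel"
    using density by (simp add: bounded_density_def f_def[abs_def])
  define D where "D = density lborel (\<lambda>x. ennreal (f x))"
  have distr: "distr P borel (X i) = D" if "i \<ge> 1" for i
  proof -
    have "distr P borel (X i) = distr P lborel (X i)" by (intro distr_cong) auto
    also have "\<dots> = D"
      using samples that by (simp add: sampling_sequences_def distributed_def D_def f_def)
    finally show ?thesis .
  qed
  have D: "prob_space D"
    using prob_space_distr[OF X_measurable[of 1]] distr[of 1] by simp
  show thesis
  proof (rule that)
    show "0 \<le> B * measure lborel (cball (0 :: real ^ 'n) 2)" using \<open>0 \<le> B\<close> by simp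
    fix I :: "nat set" and k :: nat and a b :: real
    assume I: "finite I" "I \<subseteq> {1..}" "card I = Suc k" "k > 0" and "a \<le> b"
    have "I \<noteq> {}" using I by auto
    let ?U = "{x \<in> space (\<Pi>\<^sub>M i\<in>I. borel). x ` I \<in> K UNIV b - K UNIV a}"
    have Xr: "(\<lambda>\<omega>. \<lambda>i\<in>I. X i \<omega>) \<in> measurable P (\<Pi>\<^sub>M i\<in>I. borel)"
      using I(2) X_measurable by (intro measurable_restrict) auto
    have eq: "entering a b I = (\<lambda>\<omega>. \<lambda>i\<in>I. X i \<omega>) -` ?U \<inter> space P"
      by (auto simp: space_PiM)
    have ev: "entering a b I \<in> events"
      unfolding eq by (rule measurable_sets[OF Xr sets_entering[OF I(1) \<open>I \<noteq> {}\<close>]])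
    have "indep_vars (\<lambda>_. borel) X I"
      using samples I(2) unfolding sampling_sequences_def by (metis indep_vars_subset)
    then have joint: "distr P (\<Pi>\<^sub>M i\<in>I. borel) (\<lambda>\<omega>. \<lambda>i\<in>I. X i \<omega>) = (\<Pi>\<^sub>M i\<in>I. distr P borel (X i))"
      using indep_vars_iff_distr_eq_PiM'[OF \<open>I \<noteq> {}\<close>, where M' = "\<lambda>_. borel" and X = X] I(2) X_measurable by auto
    have "emeasure P (entering a b I) = emeasure (distr P (\<Pi>\<^sub>M i\<in>I. borel) (\<lambda>\<omega>. \<lambda>i\<in>I. X i \<omega>)) ?U"
      unfolding eq by (rule emeasure_distr[symmetric, OF Xr sets_entering[OF I(1) \<open>I \<noteq> {}\<close>]])
    also have "distr P (\<Pi>\<^sub>M i\<in>I. borel) (\<lambda>\<omega>. \<lambda>i\<in>I. X i \<omega>) = (\<Pi>\<^sub>M i\<in>I. D)"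
      unfolding joint using I(2) by (intro PiM_cong distr) auto
    also have "emeasure (\<Pi>\<^sub>M i\<in>I. D) ?U \<le> ennreal B ^ k * ennreal (measure lborel (cball (0 :: real ^ 'n) 2) ^ k
        * (max 0 b ^ (DIM(real ^ 'n) * k) - max 0 a ^ (DIM(real ^ 'n) * k)))"
      by (rule emeasure_PiM_density_entering_le[OF f_meas f_le D_def D I(1,3,4) \<open>a \<le> b\<close>])
    also have "\<dots> = ennreal ((B * measure lborel (cball (0 :: real ^ 'n) 2)) ^ k
        * (max 0 b ^ (CARD('n) * k) - max 0 a ^ (CARD('n) * k)))"
    proof -
      have "max 0 a ^ (CARD('n) * k) \<le> max 0 b ^ (CARD('n) * k)"
        using \<open>a \<le> b\<close> by (intro power_mono) auto
      then show ?thesis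
        by (simp add: ennreal_power ennreal_mult[symmetric] power_mult_distrib mult.assoc \<open>0 \<le> B\<close>)
    qed
    finally show "entering a b I \<in> events \<and> emeasure P (entering a b I)
      \<le> ennreal ((B * measure lborel (cball (0 :: real ^ 'n) 2)) ^ k
        * (max 0 b ^ (CARD('n) * k) - max 0 a ^ (CARD('n) * k)))"
      using ev by blast
  qed
qed

lemma sample_size_measurable:
  "n \<ge> 1 \<Longrightarrow> sample_size sch N n \<in> measurable P (count_space UNIV)"
  using N_measurable[of n] by (cases sch) (simp_all add: sample_size_def[abs_def])

lemma sample_size_indep:
  assumes "n \<ge> 1" "finite I" "I \<noteq> {}" "I \<subseteq> {1..}"
  shows "prob (entering a b I \<inter> (sample_size sch N n -` {j} \<inter> space P))
    = prob (entering a b I) * prob (sample_size sch N n -` {j} \<inter> space P)"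
proof (cases sch)
  case Binomial
  have "sample_size sch N n -` {j} \<inter> space P = (if n = j then space P else {})"
    by (auto simp: sample_size_def Binomial)
  then show ?thesis
    by (auto simp: prob_space Int_absorb2 Collect_restrict)
next
  case Poissonized
  let ?\<Pi> = "\<Pi>\<^sub>M (i::nat)\<in>{1..}. count_space (UNIV :: nat set)"
  have "(\<lambda>x. x n) -` {j} \<inter> space ?\<Pi> \<in> sets ?\<Pi>"
    using assms(1) by (intro measurable_sets[OF measurable_component_singleton]) auto
  then have "(\<lambda>\<omega>. \<lambda>i\<in>{1..}. N i \<omega>) -` ((\<lambda>x. x n) -` {j} \<inter> space ?\<Pi>) \<inter> space P
      \<in> sets (vimage_algebra (space P) (\<lambda>\<omega>. \<lambda>i\<in>{1..}. N i \<omega>) ?\<Pi>)"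
    by (rule in_vimage_algebra)
  also have "(\<lambda>\<omega>. \<lambda>i\<in>{1..}. N i \<omega>) -` ((\<lambda>x. x n) -` {j} \<inter> space ?\<Pi>) \<inter> space P
      = sample_size sch N n -` {j} \<inter> space P"
    using assms(1) by (auto simp: sample_size_def Poissonized space_PiM)
  finally have ev: "sample_size sch N n -` {j} \<inter> space P
      \<in> sets (vimage_algebra (space P) (\<lambda>\<omega>. \<lambda>i\<in>{1..}. N i \<omega>) ?\<Pi>)" .
  have "indep_set
      (sets (vimage_algebra (space P) (\<lambda>\<omega>. \<lambda>i\<in>{1..}. X i \<omega>) (\<Pi>\<^sub>M i\<in>{1..}. borel)))
      (sets (vimage_algebra (space P) (\<lambda>\<omega>. \<lambda>i\<in>{1..}. N i \<omega>) ?\<Pi>))"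
    using samples unfolding sampling_sequences_def by blast
  from indep_setD[OF this entering_in_sigma[OF assms(2-4)] ev] show ?thesis .
qed

lemma sample_size_moment_le:
  assumes "n \<ge> 1"
  shows "(\<integral>\<^sup>+\<omega>. of_nat (sample_size sch N n \<omega> choose m) \<partial>P) \<le> ennreal (real n ^ m)"
proof (cases sch)
  case Binomial
  have "n choose m \<le> n ^ m"
    by (cases "m \<le> n") (simp_all add: binomial_le_pow binomial_eq_0)
  then have "real (n choose m) \<le> real n ^ m"
    by (metis of_nat_le_iff of_nat_power)
  then show ?thesis
    by (simp add: sample_size_def Binomial emeasure_space_1 ennreal_of_nat_eq_real_of_nat ennreal_leI)
next
  case Poissonized
  have "(\<integral>\<^sup>+\<omega>. of_nat (sample_size sch N n \<omega> choose m) \<partial>P)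
      = (\<integral>\<^sup>+j. of_nat (j choose m) \<partial>distr P (count_space UNIV) (N n))"
    using N_measurable[OF assms] by (simp add: nn_integral_distr sample_size_def Poissonized)
  also have "distr P (count_space UNIV) (N n) = measure_pmf (poisson_pmf (real n))"
    using samples assms by (simp add: sampling_sequences_def)
  also have "(\<integral>\<^sup>+j. of_nat (j choose m) \<partial>measure_pmf (poisson_pmf (real n))) = ennreal (real n ^ m / fact m)"
    using assms by (intro poisson_binomial_moment) simp
  also have "\<dots> \<le> ennreal (real n ^ m)"
    by (intro ennreal_leI) (simp add: divide_le_eq mult_le_cancel_left1 fact_ge_1)
  finally show ?thesis .
qed

text \<open>The powers of \<open>n\<close> cancel: \<open>1 / n\<close> from the normalisation,
  \<open>1 / n ^ k\<close> from the volume at the rescaled parameters, and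
  \<open>n ^ (k + 1)\<close> from the expected number of index sets.\<close>

lemma expected_scaled_diagram_strip_le:
  assumes \<pi>: "\<pi> = fst \<and> k = q \<or> \<pi> = snd \<and> k = Suc q" and "k > 0"
  obtains C where "C \<ge> 0" "\<And>n a b. n \<ge> 1 \<Longrightarrow> a \<le> b \<Longrightarrow>
    (\<integral>\<^sup>+\<omega>. emeasure (scaled_diagram K q n (sample sch X N n \<omega>)) {r \<in> R2gt. a < \<pi> r \<and> \<pi> r < b} \<partial>P)
    \<le> ennreal (C * (max 0 b ^ (CARD('n) * k) - max 0 a ^ (CARD('n) * k)))"
proof -
  obtain C where C: "C \<ge> 0" "\<And>I k a b. finite I \<Longrightarrow> I \<subseteq> {1..} \<Longrightarrow> card I = Suc k \<Longrightarrow> k > 0 \<Longrightarrow> a \<le> b \<Longrightarrow>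
    entering a b I \<in> events \<and>
    emeasure P (entering a b I) \<le> ennreal (C ^ k * (max 0 b ^ (CARD('n) * k) - max 0 a ^ (CARD('n) * k)))"
    by (rule entering_prob_le) blast
  show thesis
  proof (rule that)
    show "0 \<le> C ^ k" using C(1) by simp
    fix n a b assume n: "n \<ge> (1::nat)" and ab: "a \<le> (b::real)"
    \<comment> \<open>Dilating the sample by \<open>c\<close> amounts to dividing the two parameters
      by \<open>c\<close>, and \<open>c\<close> to the dimension is \<open>n\<close>.\<close>
    define c where "c = real n powr (1 / CARD('n))"
    have c: "c > 0" "c ^ CARD('n) = real n"
      using n by (simp_all add: c_def powr_realpow[symmetric] powr_powr)
    have ab_c: "a / c \<le> b / c" using ab c(1) by (simp add: divide_right_mono)
    let ?S = "sample_size sch N n" and ?D = "max 0 b ^ (CARD('n) * k) - max 0 a ^ (CARD('n) * k)"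
    define p where "p = ennreal (C ^ k * (max 0 (b / c) ^ (CARD('n) * k) - max 0 (a / c) ^ (CARD('n) * k)))"
    have D: "0 \<le> ?D" using ab by (simp add: power_mono)
    have p: "p = ennreal (C ^ k * ?D / real n ^ k)"
    proof -
      have "max 0 (x / c) ^ (CARD('n) * k) = max 0 x ^ (CARD('n) * k) / real n ^ k" for x
      proof -
        have "max 0 (x / c) = max 0 x / c" using c(1) by (simp add: max_def zero_le_divide_iff)
        then show ?thesis using c(2) by (simp add: power_divide power_mult)
      qed
      then show ?thesis by (simp add: p_def diff_divide_distrib[symmetric])
    qed
    have le: "emeasure (scaled_diagram K q n (sample sch X N n \<omega>)) {r \<in> R2gt. a < \<pi> r \<and> \<pi> r < b}
        \<le> ennreal (1 / real n) *
          of_nat (card {I \<in> Pow {1..?S \<omega>}. card I = Suc k \<and> \<omega> \<in> entering (a / c) (b / c) I})"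
      if "\<omega> \<in> space P" for \<omega>
    proof -
      define y where "y i = c *\<^sub>R X i \<omega>" for i
      have S: "(*\<^sub>R) (real n powr (1 / CARD('n))) ` sample sch X N n \<omega> = y ` {1..?S \<omega>}"
        unfolding sample_eq c_def[symmetric] image_image y_def ..
      have "y ` I \<in> K UNIV b - K UNIV a \<longleftrightarrow> \<omega> \<in> entering (a / c) (b / c) I" for I
        unfolding y_def using scaled_simplex_iff[OF c(1), of "\<lambda>i. X i \<omega>" I] that by simp
      then have card: "card {\<sigma> \<in> K (y ` {1..?S \<omega>}) b - K (y ` {1..?S \<omega>}) a. card \<sigma> = Suc k}
          \<le> card {I \<in> Pow {1..?S \<omega>}. card I = Suc k \<and> \<omega> \<in> entering (a / c) (b / c) I}"
        using card_simplices_image_le[of "{1..?S \<omega>}" y b a "Suc k"] by simp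
      have "emeasure (scaled_diagram K q n (sample sch X N n \<omega>)) {r \<in> R2gt. a < \<pi> r \<and> \<pi> r < b}
          = ennreal (1 / real n) * emeasure (diagram_measure (dgm (K (y ` {1..?S \<omega>})) q)) {r \<in> R2gt. a < \<pi> r \<and> \<pi> r < b}"
        unfolding scaled_diagram_def S by simp
      also have "\<dots> \<le> ennreal (1 / real n) * of_nat (card {\<sigma> \<in> K (y ` {1..?S \<omega>}) b - K (y ` {1..?S \<omega>}) a. card \<sigma> = Suc k})"
        using \<pi> by (intro mult_left_mono emeasure_diagram_strip_le[OF _ ab]) auto
      also have "\<dots> \<le> ennreal (1 / real n) * of_nat (card {I \<in> Pow {1..?S \<omega>}. card I = Suc k \<and> \<omega> \<in> entering (a / c) (b / c) I})"
        using card by (intro mult_left_mono of_nat_mono) auto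
      finally show ?thesis .
    qed
    \<comment> \<open>Measurability is asked of this counting function; the step from the diagram to
      it is \<open>nn_integral_mono\<close>, which holds for arbitrary functions.\<close>
    have meas: "(\<lambda>\<omega>. of_nat (card {I \<in> Pow {1..?S \<omega>}. card I = Suc k \<and> \<omega> \<in> entering (a / c) (b / c) I}) :: ennreal)
        \<in> borel_measurable P"
    proof (rule measurable_compose_countable[OF _ sample_size_measurable[OF n], where sch1 = sch])
      fix j
      have ev: "entering (a / c) (b / c) I \<in> events" if "I \<in> {I \<in> Pow {1..j}. card I = Suc k}" for I
      proof -
        have "finite I" "I \<subseteq> {1..}" "card I = Suc k"
          using that finite_subset[of I "{1..j}"] by auto
        from C(2)[OF this \<open>k > 0\<close> ab_c] show ?thesis ..
      qed
      have "of_nat (card {I \<in> Pow {1..j}. card I = Suc k \<and> \<omega> \<in> entering (a / c) (b / c) I})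
          = (\<Sum>I\<in>{I \<in> Pow {1..j}. card I = Suc k}. indicator (entering (a / c) (b / c) I) \<omega> :: ennreal)" for \<omega>
      proof -
        have "(\<Sum>I\<in>{I \<in> Pow {1..j}. card I = Suc k}. indicator (entering (a / c) (b / c) I) \<omega> :: ennreal)
            = (\<Sum>I\<in>{I \<in> Pow {1..j}. card I = Suc k \<and> \<omega> \<in> entering (a / c) (b / c) I}. 1)"
          by (intro sum.mono_neutral_cong_right) auto
        then show ?thesis by simp
      qed
      then show "(\<lambda>\<omega>. of_nat (card {I \<in> Pow {1..j}. card I = Suc k \<and> \<omega> \<in> entering (a / c) (b / c) I}) :: ennreal)
          \<in> borel_measurable P"
        by (simp only:) (intro borel_measurable_sum borel_measurable_indicator ev)
    qed
    have "(\<integral>\<^sup>+\<omega>. emeasure (scaled_diagram K q n (sample sch X N n \<omega>)) {r \<in> R2gt. a < \<pi> r \<and> \<pi> r < b} \<partial>P)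
        \<le> (\<integral>\<^sup>+\<omega>. ennreal (1 / real n) *
          of_nat (card {I \<in> Pow {1..?S \<omega>}. card I = Suc k \<and> \<omega> \<in> entering (a / c) (b / c) I}) \<partial>P)"
      by (intro nn_integral_mono le)
    also have "\<dots> = ennreal (1 / real n) *
        (\<integral>\<^sup>+\<omega>. of_nat (card {I \<in> Pow {1..?S \<omega>}. card I = Suc k \<and> \<omega> \<in> entering (a / c) (b / c) I}) \<partial>P)"
      by (rule nn_integral_cmult[OF meas])
    also have "\<dots> \<le> ennreal (1 / real n) * (p * (\<integral>\<^sup>+\<omega>. of_nat (?S \<omega> choose Suc k) \<partial>P))"
    proof (intro mult_left_mono expected_number_of_events_le sample_size_measurable n)
      fix I :: "nat set" assume I: "finite I" "I \<subseteq> {1..}" "card I = Suc k"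
      show "entering (a / c) (b / c) I \<in> events \<and> emeasure P (entering (a / c) (b / c) I) \<le> p"
        unfolding p_def by (rule C(2)[OF I \<open>k > 0\<close> ab_c])
      have "I \<noteq> {}" using I by auto
      then show "prob (entering (a / c) (b / c) I \<inter> (?S -` {j} \<inter> space P))
          = prob (entering (a / c) (b / c) I) * prob (?S -` {j} \<inter> space P)" for j
        using I by (intro sample_size_indep n)
    qed simp
    also have "\<dots> \<le> ennreal (1 / real n) * (p * ennreal (real n ^ Suc k))"
      by (intro mult_left_mono sample_size_moment_le n) auto
    also have "\<dots> = ennreal (1 / real n * (C ^ k * ?D / real n ^ k * real n ^ Suc k))"
      using C(1) D unfolding p by (simp only: ennreal_mult''[symmetric] zero_le_power of_nat_0_le_iff
          zero_le_mult_iff zero_le_divide_iff simp_thms)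
    also have "1 / real n * (C ^ k * ?D / real n ^ k * real n ^ Suc k) = C ^ k * ?D"
      using n by simp
    finally show "(\<integral>\<^sup>+\<omega>. emeasure (scaled_diagram K q n (sample sch X N n \<omega>)) {r \<in> R2gt. a < \<pi> r \<and> \<pi> r < b} \<partial>P)
        \<le> ennreal (C ^ k * ?D)" .
  qed
qed

end

section \<open>Densities\<close>

text \<open>The null set is covered by countably many intervals inside the window with small total
  length, and the bound on intervals carries over to the union by subadditivity.\<close>

lemma null_set_of_interval_bound:
  fixes \<nu> :: "real measure"
  assumes sets: "sets \<nu> = sets borel" and "0 \<le> L"
    and bound: "\<And>a b. -M \<le> a \<Longrightarrow> a \<le> b \<Longrightarrow> b \<le> M \<Longrightarrow> emeasure \<nu> {a..b} \<le> ennreal (L * (b - a))"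
    and S: "S \<in> null_sets lborel" "S \<subseteq> {-M..M}"
  shows "emeasure \<nu> S = 0"
proof -
  note [measurable_cong] = sets
  have leb: "S \<in> lmeasurable" "measure lebesgue S = 0"
    using null_sets_completionI[OF S(1)] by (auto simp: null_sets_def fmeasurable_def measure_def)
  have "emeasure \<nu> S \<le> ennreal L * ennreal e" if "e > 0" for e
  proof -
    obtain \<D> where \<D>: "countable \<D>"
        "\<And>K. K \<in> \<D> \<Longrightarrow> K \<subseteq> cbox (-M) M \<and> K \<noteq> {} \<and> (\<exists>c d. K = cbox c d)"
        "pairwise (\<lambda>A B. interior A \<inter> interior B = {}) \<D>"
        "S \<subseteq> \<Union>\<D>" "\<Union>\<D> \<in> lmeasurable" "measure lebesgue (\<Union>\<D>) \<le> measure lebesgue S + e"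
      by (rule measurable_outer_intervals_bounded[of S "-M" M e])
        (use leb S \<open>e > 0\<close> in \<open>auto simp: cbox_interval\<close>)
    have borel: "K \<in> sets borel" if "K \<in> \<D>" for K
      using \<D>(2)[OF that] by auto
    have disj: "disjoint_family_on interior \<D>"
      using \<D>(3) by (auto simp: disjoint_family_on_def pairwise_def)
    have UD: "\<Union>\<D> \<in> sets borel"
      using \<D>(1) borel by (intro sets.countable_Union) auto
    have K: "emeasure \<nu> K \<le> ennreal L * emeasure lborel (interior K)" if K: "K \<in> \<D>" for K
    proof -
      obtain c d where cd: "K = {c..d}" "c \<le> d" "-M \<le> c" "d \<le> M"
        using \<D>(2)[OF K] by (auto simp: cbox_interval)
      have "emeasure \<nu> K \<le> ennreal (L * (d - c))"
        using bound[of c d] cd by simp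
      also have "\<dots> = ennreal L * emeasure lborel (interior K)"
        using cd \<open>0 \<le> L\<close> by (simp add: ennreal_mult)
      finally show ?thesis .
    qed
    have "emeasure \<nu> S \<le> emeasure \<nu> (\<Union>\<D>)"
      using \<D>(4) UD by (intro emeasure_mono) (simp_all add: sets)
    also have "\<dots> = (\<integral>\<^sup>+x. indicator (\<Union>\<D>) x \<partial>\<nu>)"
      using UD by (simp add: sets)
    \<comment> \<open>The intervals may share end points, so \<nu> is only subadditive on them;
      lengths are summed over the interiors, which are disjoint. Sums over the unindexed countable
      family are integrals over \<open>count_space\<close>.\<close>
    also have "\<dots> \<le> (\<integral>\<^sup>+x. \<integral>\<^sup>+K. indicator K x \<partial>count_space \<D> \<partial>\<nu>)"
    proof (rule nn_integral_mono)
      fix x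
      show "indicator (\<Union>\<D>) x \<le> (\<integral>\<^sup>+K. indicator K x \<partial>count_space \<D>)"
      proof (cases "x \<in> \<Union>\<D>")
        case True
        then obtain K where "K \<in> \<D>" "x \<in> K" by blast
        then show ?thesis
          using nn_integral_ge_point[of K \<D> "\<lambda>K. indicator K x"] True by simp
      qed simp
    qed
    also have "\<dots> = (\<integral>\<^sup>+K. \<integral>\<^sup>+x. indicator K x \<partial>\<nu> \<partial>count_space \<D>)"
      using \<D>(1) borel by (intro nn_integral_count_space_nn_integral) (auto simp: sets)
    also have "\<dots> \<le> (\<integral>\<^sup>+K. ennreal L * emeasure lborel (interior K) \<partial>count_space \<D>)"
      using borel K by (intro nn_integral_mono) (simp add: sets)
    also have "\<dots> = ennreal L * (\<integral>\<^sup>+K. emeasure lborel (interior K) \<partial>count_space \<D>)"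
      by (intro nn_integral_cmult) simp
    also have "(\<integral>\<^sup>+K. emeasure lborel (interior K) \<partial>count_space \<D>) = emeasure lborel (\<Union>K\<in>\<D>. interior K)"
      using \<D>(1) disj by (intro emeasure_UN_countable[symmetric]) auto
    also have "\<dots> \<le> emeasure lborel (\<Union>\<D>)"
      using UD interior_subset by (intro emeasure_mono) fastforce+
    also have "\<dots> = ennreal (measure lebesgue (\<Union>\<D>))"
      using emeasure_eq_measure2[OF \<D>(5)] UD by simp
    also have "\<dots> \<le> ennreal e"
      using \<D>(6) leb(2) by (intro ennreal_leI) simp
    finally show ?thesis by (simp add: mult_left_mono)
  qed
  note small = this
  have le_e: "emeasure \<nu> S \<le> 0 + ennreal e" if "e > 0" for e :: real
  proof -
    \<comment> \<open>\<open>L\<close> may be 0, hence the division by \<open>L + 1\<close>.\<close>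
    have "emeasure \<nu> S \<le> ennreal L * ennreal (e / (L + 1))"
      using that \<open>0 \<le> L\<close> by (intro small) simp
    also have "\<dots> = ennreal (L * (e / (L + 1)))"
      using that \<open>0 \<le> L\<close> by (intro ennreal_mult[symmetric]) auto
    also have "\<dots> \<le> ennreal e"
      using that \<open>0 \<le> L\<close> by (intro ennreal_leI) (simp add: field_simps)
    finally show ?thesis by simp
  qed
  have "emeasure \<nu> S \<le> 0"
    by (rule ennreal_le_epsilon) (rule le_e)
  then show ?thesis by simp
qed

text \<open>The constant may depend on the window: absolute continuity and \<sigma>-finiteness are
  both checked on the exhausting intervals from \<open>-n\<close> to \<open>n\<close>.\<close>

lemma has_lebesgue_density_of_interval_bound:
  fixes \<nu> :: "real measure"
  assumes sets: "sets \<nu> = sets borel"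
    and bound: "\<And>M. M \<ge> 0 \<Longrightarrow> \<exists>L\<ge>0. \<forall>a b. -M \<le> a \<longrightarrow> a \<le> b \<longrightarrow> b \<le> M \<longrightarrow>
      emeasure \<nu> {a..b} \<le> ennreal (L * (b - a))"
  shows "has_lebesgue_density \<nu>"
proof -
  have space: "space \<nu> = UNIV"
    using sets_eq_imp_space_eq[OF sets] by simp
  have cover: "(\<Union>n. {- real n..real n}) = (UNIV :: real set)"
  proof -
    have "\<exists>n. - real n \<le> x \<and> x \<le> real n" for x :: real
    proof -
      obtain n where "\<bar>x\<bar> \<le> real n" using real_arch_simple by blast
      then show ?thesis by (intro exI[of _ n]) linarith
    qed
    then show ?thesis by auto
  qed
  have ac: "absolutely_continuous lborel \<nu>"
    unfolding absolutely_continuous_def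
  proof
    fix A :: "real set" assume A: "A \<in> null_sets lborel"
    have "emeasure \<nu> (A \<inter> {- real n..real n}) = 0" for n
    proof -
      obtain L where L: "L \<ge> 0" "\<And>a b. - real n \<le> a \<Longrightarrow> a \<le> b \<Longrightarrow> b \<le> real n \<Longrightarrow>
          emeasure \<nu> {a..b} \<le> ennreal (L * (b - a))"
        using bound[of "real n"] by auto
      show ?thesis
        by (rule null_set_of_interval_bound[OF sets L(1), of "real n"])
          (use A L(2) in \<open>auto intro: null_set_Int2\<close>)
    qed
    then have "(\<Union>n. A \<inter> {- real n..real n}) \<in> null_sets \<nu>"
      using A by (intro null_sets_UN') (auto simp: null_sets_def sets)
    then show "A \<in> null_sets \<nu>"
      unfolding Int_UN_distrib[symmetric] cover by simp
  qed
  have sf: "sigma_finite_measure \<nu>"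
  proof
    have "emeasure \<nu> {- real n..real n} \<noteq> \<infinity>" for n
    proof -
      obtain L where "\<And>a b. - real n \<le> a \<Longrightarrow> a \<le> b \<Longrightarrow> b \<le> real n \<Longrightarrow>
          emeasure \<nu> {a..b} \<le> ennreal (L * (b - a))"
        using bound[of "real n"] by auto
      from this[of "- real n" "real n"] show ?thesis by (auto simp: top_unique)
    qed
    then show "\<exists>A. countable A \<and> A \<subseteq> sets \<nu> \<and> \<Union> A = space \<nu> \<and> (\<forall>a\<in>A. emeasure \<nu> a \<noteq> \<infinity>)"
      using cover by (intro exI[of _ "range (\<lambda>n. {- real n..real n})"]) (auto simp: sets space)
  qed
  have sets': "sets \<nu> = sets lborel" by (simp add: sets)
  \<comment> \<open>The density must be real-valued. As \<nu> is \<sigma>-finite, its derivative is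
    finite almost everywhere, and \<open>enn2real\<close> alters it on a null set only.\<close>
  have fin: "AE x in lborel. RN_deriv lborel \<nu> x \<noteq> \<infinity>"
    by (rule sigma_finite_measure.RN_deriv_finite[OF sigma_finite_lborel sf ac sets'])
  have "\<nu> = density lborel (RN_deriv lborel \<nu>)"
    by (rule sigma_finite_measure.density_RN_deriv[OF sigma_finite_lborel ac sets', symmetric])
  also have "\<dots> = density lborel (\<lambda>x. ennreal (enn2real (RN_deriv lborel \<nu> x)))"
    using fin by (intro density_cong) (auto simp: less_top elim!: eventually_mono)
  finally have "\<nu> = density lborel (\<lambda>x. ennreal (enn2real (RN_deriv lborel \<nu> x)))" .
  then show ?thesis
    unfolding has_lebesgue_density_def
    by (intro exI[of _ "\<lambda>x. enn2real (RN_deriv lborel \<nu> x)"]) auto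
qed

text \<open>By induction on \<open>m\<close> through \<open>y ^ (m + 1) - x ^ (m + 1) = y * (y ^ m -
  x ^ m) + x ^ m * (y - x)\<close>.\<close>

lemma power_lipschitz:
  fixes M :: real
  assumes "M \<ge> 0"
  shows "\<exists>L\<ge>0. \<forall>x y. 0 \<le> x \<longrightarrow> x \<le> y \<longrightarrow> y \<le> M \<longrightarrow> y ^ m - x ^ m \<le> L * (y - x)"
proof (induction m)
  case 0
  then show ?case by (intro exI[of _ 0]) auto
next
  case (Suc m)
  then obtain L where L: "L \<ge> 0" "\<And>x y. 0 \<le> x \<Longrightarrow> x \<le> y \<Longrightarrow> y \<le> M \<Longrightarrow> y ^ m - x ^ m \<le> L * (y - x)"
    by blast
  have "y ^ Suc m - x ^ Suc m \<le> (M * L + M ^ m) * (y - x)" if "0 \<le> x" "x \<le> y" "y \<le> M" for x y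
  proof -
    have "y * (y ^ m - x ^ m) \<le> M * (L * (y - x))"
      using that L assms by (intro mult_mono) (auto simp: power_mono)
    moreover have "x ^ m * (y - x) \<le> M ^ m * (y - x)"
      using that by (intro mult_right_mono power_mono) auto
    ultimately show ?thesis by (simp add: algebra_simps)
  qed
  then show ?case
    using L(1) assms by (intro exI[of _ "M * L + M ^ m"]) auto
qed

text \<open>For \<open>a \<le> b\<close> the sum of the two maxima is the distance from
  \<open>x\<close> to the interval from \<open>a\<close> to \<open>b\<close>, so this is the usual
  piecewise linear cut-off with flanks of width \<delta>.\<close>

definition trapezoid :: "real \<Rightarrow> real \<Rightarrow> real \<Rightarrow> real \<Rightarrow> real" where
  "trapezoid \<delta> a b x = max 0 (1 - (max 0 (a - x) + max 0 (x - b)) / \<delta>)"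

lemma trapezoid:
  assumes "\<delta> > 0"
  shows "0 \<le> trapezoid \<delta> a b x" "trapezoid \<delta> a b x \<le> 1"
    and "a \<le> x \<Longrightarrow> x \<le> b \<Longrightarrow> trapezoid \<delta> a b x = 1"
    and "trapezoid \<delta> a b x \<noteq> 0 \<Longrightarrow> a - \<delta> < x \<and> x < b + \<delta>"
proof -
  show "trapezoid \<delta> a b x \<noteq> 0 \<Longrightarrow> a - \<delta> < x \<and> x < b + \<delta>"
  proof -
    assume "trapezoid \<delta> a b x \<noteq> 0"
    then have "(max 0 (a - x) + max 0 (x - b)) / \<delta> < 1"
      unfolding trapezoid_def by linarith
    then have "max 0 (a - x) + max 0 (x - b) < \<delta>" using assms by simp
    then show ?thesis by linarith
  qed
qed (use assms in \<open>auto simp: trapezoid_def\<close>)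

lemma continuous_on_trapezoid [continuous_intros]:
  "continuous_on A f \<Longrightarrow> continuous_on A (\<lambda>x. trapezoid \<delta> a b (f x))"
  unfolding trapezoid_def divide_inverse
  by (intro continuous_on_max continuous_on_diff continuous_on_add continuous_on_mult_right continuous_on_const)

text \<open>The trapezoid alone does not vanish at the diagonal. The second factor enforces this and
  equals 1 as soon as the persistence reaches \<epsilon>.\<close>

lemma test_function_trapezoid:
  assumes \<pi>: "\<pi> = fst \<or> \<pi> = snd" and "\<delta> > 0" "\<epsilon> > 0"
  shows "test_function (\<lambda>r. trapezoid \<delta> a b (\<pi> r) * min 1 (pers r / \<epsilon>))"
    (is "test_function ?\<phi>")
  unfolding test_function_def
proof (intro conjI)
  show "continuous_on R2gt ?\<phi>"
    using \<pi> \<open>\<epsilon> > 0\<close> unfolding pers_def by (auto intro!: continuous_intros)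
  have abs_le: "\<bar>?\<phi> r\<bar> \<le> min 1 (pers r / \<epsilon>)" if "r \<in> R2gt" for r
  proof -
    have "0 \<le> pers r / \<epsilon>" using that \<open>\<epsilon> > 0\<close> by (simp add: R2gt_def pers_def)
    then show ?thesis
      using trapezoid(1,2)[OF \<open>\<delta> > 0\<close>, of a b "\<pi> r"]
        mult_right_mono[of "trapezoid \<delta> a b (\<pi> r)" 1 "min 1 (pers r / \<epsilon>)"] by (simp add: abs_mult)
  qed
  show "((\<lambda>e. SUP r\<in>{r \<in> R2gt. pers r \<le> e}. ennreal \<bar>?\<phi> r\<bar>) \<longlongrightarrow> 0) (at_right 0)"
  proof (rule tendsto_sandwich[where f = "\<lambda>_. 0" and h = "\<lambda>e. ennreal (e / \<epsilon>)"])
    show "\<forall>\<^sub>F e in at_right 0. (SUP r\<in>{r \<in> R2gt. pers r \<le> e}. ennreal \<bar>?\<phi> r\<bar>) \<le> ennreal (e / \<epsilon>)"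
    proof (intro always_eventually allI SUP_least ennreal_leI)
      fix e r assume r: "r \<in> {r \<in> R2gt. pers r \<le> e}"
      then have "pers r / \<epsilon> \<le> e / \<epsilon>" using \<open>\<epsilon> > 0\<close> by (simp add: divide_right_mono)
      then show "\<bar>?\<phi> r\<bar> \<le> e / \<epsilon>" using abs_le[of r] r by simp
    qed
    have "((\<lambda>e. ennreal (e / \<epsilon>)) \<longlongrightarrow> ennreal (0 / \<epsilon>)) (at_right 0)"
      using \<open>\<epsilon> > 0\<close> by (intro tendsto_ennrealI tendsto_intros) auto
    then show "((\<lambda>e. ennreal (e / \<epsilon>)) \<longlongrightarrow> 0) (at_right 0)" by simp
  qed simp_all
  show "\<exists>A>0. \<exists>\<alpha>>0. \<forall>r\<in>R2gt. \<bar>?\<phi> r\<bar> \<le> A * (1 + pers r powr \<alpha>)"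
  proof (intro exI[of _ "1::real"] conjI ballI)
    fix r assume "r \<in> R2gt"
    then show "\<bar>?\<phi> r\<bar> \<le> 1 * (1 + pers r powr 1)"
      using abs_le[of r] powr_ge_zero[of "pers r" 1]
        min.cobounded1[of 1 "pers r / \<epsilon>"] by (smt (verit))
  qed simp_all
qed

text \<open>The integral of a non-integrable function is 0 by convention, which respects the bound
  because \<open>c\<close> is non-negative; so the estimate can be used without checking
  integrability.\<close>

lemma integral_le_emeasure:
  assumes "A \<in> sets M" "emeasure M A \<le> ennreal c" "0 \<le> c"
    and "\<And>x. x \<in> space M \<Longrightarrow> 0 \<le> f x \<and> f x \<le> indicator A x"
  shows "integral\<^sup>L M f \<le> c"
proof (cases "integrable M f")
  case True
  have "ennreal (integral\<^sup>L M f) = (\<integral>\<^sup>+x. ennreal (f x) \<partial>M)"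
    using assms(4) True by (intro nn_integral_eq_integral[symmetric]) auto
  also have "\<dots> \<le> (\<integral>\<^sup>+x. indicator A x \<partial>M)"
  proof (rule nn_integral_mono)
    fix x assume "x \<in> space M"
    then show "ennreal (f x) \<le> indicator A x"
      using assms(4)[of x] by (cases "x \<in> A") auto
  qed
  also have "\<dots> \<le> ennreal c" using assms by simp
  finally show ?thesis using assms(3) by simp
qed (simp add: not_integrable_integral_eq assms(3))

text \<open>Three limits in turn: \<open>n\<close> to infinity for a fixed test function, then
  \<epsilon> to 0 by exhausting the strip with its parts of persistence at least \<epsilon>, then
  \<delta> to 0 by continuity of \<open>G\<close>.\<close>

lemma limit_strip_le:
  assumes limit: "is_limit_diagram P K q S \<mu>" and \<pi>: "\<pi> = fst \<or> \<pi> = snd"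
    and bound: "\<And>n a b. n \<ge> 1 \<Longrightarrow> a \<le> b \<Longrightarrow>
      (\<integral>\<^sup>+\<omega>. emeasure (scaled_diagram K q n (S \<omega> n)) {r \<in> R2gt. a < \<pi> r \<and> \<pi> r < b} \<partial>P) \<le> ennreal (G b - G a)"
    and G: "continuous_on UNIV G" "mono G"
    and "a \<le> b"
  shows "emeasure \<mu> {r \<in> R2gt. a \<le> \<pi> r \<and> \<pi> r \<le> b} \<le> ennreal (G b - G a)"
proof -
  have sets: "sets \<mu> = sets (restrict_space borel R2gt)"
    using limit by (simp add: is_limit_diagram_def radon_measure_R2gt_def)
  have space: "space \<mu> = R2gt"
    using sets_eq_imp_space_eq[OF sets] by (simp add: space_restrict_space)
  let ?T = "\<lambda>\<epsilon>. {r \<in> R2gt. a \<le> \<pi> r \<and> \<pi> r \<le> b \<and> \<epsilon> \<le> pers r}"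
  have G_diff: "0 \<le> G (b + \<delta>) - G (a - \<delta>)" if "\<delta> > 0" for \<delta>
    using that \<open>a \<le> b\<close> monoD[OF G(2), of "a - \<delta>" "b + \<delta>"] by simp
  have [measurable]: "\<pi> \<in> borel_measurable \<mu>" "pers \<in> borel_measurable \<mu>"
  proof -
    have "continuous_on R2gt \<pi>" "continuous_on R2gt pers"
      using \<pi> unfolding pers_def[abs_def] by (auto intro!: continuous_intros)
    from this[THEN borel_measurable_continuous_on_restrict]
    show "\<pi> \<in> borel_measurable \<mu>" "pers \<in> borel_measurable \<mu>"
      by (simp_all cong: measurable_cong_sets add: sets)
  qed
  have T_sets: "?T \<epsilon> \<in> sets \<mu>" for \<epsilon>
    unfolding space[symmetric] by measurable
  have T_le: "emeasure \<mu> (?T \<epsilon>) \<le> ennreal (G (b + \<delta>) - G (a - \<delta>))" if "\<delta> > 0" "\<epsilon> > 0" for \<delta> \<epsilon>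
  proof -
    define \<phi> where "\<phi> r = trapezoid \<delta> a b (\<pi> r) * min 1 (pers r / \<epsilon>)" for r
    let ?A = "{r \<in> R2gt. a - \<delta> < \<pi> r \<and> \<pi> r < b + \<delta>}"
    let ?E = "\<lambda>n. expected_measure P (\<lambda>\<omega>. scaled_diagram K q n (S \<omega> n))"
    have "test_function \<phi>"
      using test_function_trapezoid[OF \<pi> that] unfolding \<phi>_def[abs_def] .
    then have int: "integrable \<mu> \<phi>" and lim: "(\<lambda>n. integral\<^sup>L (?E n) \<phi>) \<longlonglongrightarrow> integral\<^sup>L \<mu> \<phi>"
      using limit by (auto simp: is_limit_diagram_def)
    have \<phi>: "0 \<le> \<phi> r" "\<phi> r \<le> indicator ?A r" if "r \<in> R2gt" for r
    proof -
      have "0 \<le> pers r / \<epsilon>" using that \<open>\<epsilon> > 0\<close> by (simp add: R2gt_def pers_def)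
      then show "0 \<le> \<phi> r"
        using trapezoid(1)[OF \<open>\<delta> > 0\<close>] by (simp add: \<phi>_def)
      have "\<phi> r \<le> 1"
        using trapezoid(1,2)[OF \<open>\<delta> > 0\<close>, of a b "\<pi> r"] \<open>0 \<le> pers r / \<epsilon>\<close>
          mult_mono[of "trapezoid \<delta> a b (\<pi> r)" 1 "min 1 (pers r / \<epsilon>)" 1] by (simp add: \<phi>_def)
      moreover have "r \<in> ?A" if "\<phi> r \<noteq> 0"
        using trapezoid(4)[OF \<open>\<delta> > 0\<close>, of a b "\<pi> r"] that \<open>r \<in> R2gt\<close> by (simp add: \<phi>_def)
      ultimately show "\<phi> r \<le> indicator ?A r" by (cases "\<phi> r = 0") auto
    qed
    have "integral\<^sup>L (?E n) \<phi> \<le> G (b + \<delta>) - G (a - \<delta>)" if n: "n \<ge> 1" for n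
    proof (rule integral_le_emeasure)
      have subset: "sets (restrict_space borel R2gt) \<subseteq> Pow R2gt"
        using sets.sets_into_space[of _ "restrict_space borel R2gt"] by (auto simp: space_restrict_space)
      have sE: "sets (?E n) = sets (restrict_space borel R2gt)"
        using subset sets.sigma_sets_eq[of "restrict_space borel R2gt"]
        unfolding expected_measure_def by (simp add: sets_measure_of space_restrict_space)
      show "?A \<in> sets (?E n)"
        unfolding sE using \<pi> by (rule sets_R2gt_strip)
      \<comment> \<open>By the convention of \<open>measure_of\<close> the left side is 0 should the
        set function fail to be a measure; the inequality holds in either case.\<close>
      have "emeasure (?E n) ?A \<le> (\<integral>\<^sup>+\<omega>. emeasure (scaled_diagram K q n (S \<omega> n)) ?A \<partial>P)"
        unfolding expected_measure_def by (subst emeasure_measure_of_conv) simp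
      also have "\<dots> \<le> ennreal (G (b + \<delta>) - G (a - \<delta>))"
        using \<open>\<delta> > 0\<close> \<open>a \<le> b\<close> by (intro bound n) simp
      finally show "emeasure (?E n) ?A \<le> ennreal (G (b + \<delta>) - G (a - \<delta>))" .
      show "0 \<le> G (b + \<delta>) - G (a - \<delta>)" by (rule G_diff) fact
      have "space (?E n) = R2gt"
        using subset unfolding expected_measure_def by (simp add: space_measure_of)
      then show "0 \<le> \<phi> r \<and> \<phi> r \<le> indicator ?A r" if "r \<in> space (?E n)" for r
        using \<phi> that by simp
    qed
    then have int_le: "integral\<^sup>L \<mu> \<phi> \<le> G (b + \<delta>) - G (a - \<delta>)"
      by (intro LIMSEQ_le_const2[OF lim]) blast
    have "emeasure \<mu> (?T \<epsilon>) = (\<integral>\<^sup>+r. indicator (?T \<epsilon>) r \<partial>\<mu>)"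
      using T_sets by simp
    also have "\<dots> \<le> (\<integral>\<^sup>+r. ennreal (\<phi> r) \<partial>\<mu>)"
    proof (rule nn_integral_mono)
      fix r assume "r \<in> space \<mu>"
      have "\<phi> r = 1" if "r \<in> ?T \<epsilon>"
        using that trapezoid(3)[OF \<open>\<delta> > 0\<close>, of a "\<pi> r" b] \<open>\<epsilon> > 0\<close> by (simp add: \<phi>_def min_def)
      then show "indicator (?T \<epsilon>) r \<le> ennreal (\<phi> r)" by (auto simp: indicator_def)
    qed
    also have "\<dots> = ennreal (integral\<^sup>L \<mu> \<phi>)"
      using int \<phi> by (intro nn_integral_eq_integral) (auto simp: space)
    also have "\<dots> \<le> ennreal (G (b + \<delta>) - G (a - \<delta>))"
      by (rule ennreal_leI) fact
    finally show ?thesis .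
  qed
  have "{r \<in> R2gt. a \<le> \<pi> r \<and> \<pi> r \<le> b} = (\<Union>i. ?T (1 / Suc i))"
  proof -
    have "\<exists>i. 1 / real (Suc i) \<le> pers r" if "r \<in> R2gt" for r
      using reals_Archimedean[of "pers r"] that
      by (auto simp: R2gt_def pers_def inverse_eq_divide intro: less_imp_le)
    then show ?thesis by auto
  qed
  moreover have "emeasure \<mu> (\<Union>i. ?T (1 / Suc i)) = (SUP i. emeasure \<mu> (?T (1 / Suc i)))"
  proof (rule SUP_emeasure_incseq[symmetric])
    have "1 / real (Suc j) \<le> 1 / real (Suc i)" if "i \<le> j" for i j
      using that by (intro divide_left_mono) auto
    then show "incseq (\<lambda>i. ?T (1 / Suc i))"
      by (force simp: incseq_def intro: order_trans)
  qed (use T_sets in auto)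
  ultimately have le: "emeasure \<mu> {r \<in> R2gt. a \<le> \<pi> r \<and> \<pi> r \<le> b} \<le> ennreal (G (b + \<delta>) - G (a - \<delta>))"
    if "\<delta> > 0" for \<delta>
    using T_le[OF that] by (simp add: SUP_least)
  have "((\<lambda>\<delta>. ennreal (G (b + \<delta>) - G (a - \<delta>))) \<longlongrightarrow> ennreal (G (b + 0) - G (a - 0))) (at_right 0)"
    by (intro tendsto_ennrealI tendsto_diff continuous_on_tendsto_compose[OF G(1)] tendsto_intros) auto
  then show ?thesis
    using le by (intro tendsto_lowerbound[of _ "ennreal (G b - G a)" "at_right (0::real)"])
      (auto intro: eventually_at_right_less eventually_mono)
qed

theorem proposition4p7:
  fixes P :: "'w measure"
    and \<kappa> :: "real ^ 'n \<Rightarrow> real"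
    and X :: "nat \<Rightarrow> 'w \<Rightarrow> real ^ 'n"
    and N :: "nat \<Rightarrow> 'w \<Rightarrow> nat"
    and K :: "(real ^ 'n) set \<Rightarrow> (real ^ 'n) filtration"
    and sch :: scheme
    and q :: nat
    and \<mu> :: "(real \<times> real) measure"
  assumes "prob_space P"
    and "K = cech \<or> K = rips"
    and "bounded_density \<kappa>"
    and "sampling_sequences P \<kappa> X N"
    and "is_limit_diagram P K q (\<lambda>\<omega> n. sample sch X N n \<omega>) \<mu>"
  shows "(q > 0 \<longrightarrow> has_lebesgue_density (distr \<mu> lborel fst) \<and>
                  has_lebesgue_density (distr \<mu> lborel snd)) \<and>
         (q = 0 \<longrightarrow> has_lebesgue_density (distr \<mu> lborel snd))"
proof -
  have "homogeneous_filtration K"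
    using assms(2) homogeneous_filtration_cech homogeneous_filtration_rips by blast
  then interpret random_sample K P \<kappa> X N
    using assms by (intro random_sample.intro random_sample_axioms.intro)
  have sets: "sets \<mu> = sets (restrict_space borel R2gt)"
    using assms(5) by (simp add: is_limit_diagram_def radon_measure_R2gt_def)
  have space: "space \<mu> = R2gt"
    using sets_eq_imp_space_eq[OF sets] by (simp add: space_restrict_space)
  have density: "has_lebesgue_density (distr \<mu> lborel \<pi>)"
    if \<pi>: "\<pi> = fst \<and> k = q \<or> \<pi> = snd \<and> k = Suc q" and k: "k > 0" for \<pi> k
  proof -
    let ?m = "CARD('n) * k"
    obtain C where C: "C \<ge> 0" "\<And>n a b. n \<ge> 1 \<Longrightarrow> a \<le> b \<Longrightarrow>
        (\<integral>\<^sup>+\<omega>. emeasure (scaled_diagram K q n (sample sch X N n \<omega>)) {r \<in> R2gt. a < \<pi> r \<and> \<pi> r < b} \<partial>P)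
        \<le> ennreal (C * (max 0 b ^ ?m - max 0 a ^ ?m))"
      using expected_scaled_diagram_strip_le[OF \<pi> k, of sch] by blast
    define G where "G t = C * max 0 t ^ ?m" for t :: real
    have G_cont: "continuous_on UNIV G"
      unfolding G_def by (intro continuous_intros)
    have G_mono: "mono G"
      unfolding G_def using C(1) by (intro monoI mult_left_mono power_mono) auto
    have strip: "emeasure \<mu> {r \<in> R2gt. a \<le> \<pi> r \<and> \<pi> r \<le> b} \<le> ennreal (G b - G a)" if "a \<le> b" for a b
    proof (rule limit_strip_le[OF assms(5) _ _ G_cont G_mono that])
      show "\<pi> = fst \<or> \<pi> = snd" using \<pi> by auto
      show "(\<integral>\<^sup>+\<omega>. emeasure (scaled_diagram K q n (sample sch X N n \<omega>)) {r \<in> R2gt. a < \<pi> r \<and> \<pi> r < b} \<partial>P)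
          \<le> ennreal (G b - G a)" if "n \<ge> 1" "a \<le> b" for n a b
        using C(2)[OF that] by (simp only: G_def right_diff_distrib)
    qed
    have "continuous_on R2gt \<pi>"
      using \<pi> by (auto intro!: continuous_intros)
    then have \<pi>_meas: "\<pi> \<in> measurable \<mu> lborel"
      using borel_measurable_continuous_on_restrict[of R2gt \<pi>]
      by (simp cong: measurable_cong_sets add: sets)
    show ?thesis
    proof (rule has_lebesgue_density_of_interval_bound)
      fix M :: real assume "M \<ge> 0"
      from power_lipschitz[OF this, of ?m] obtain L where L: "L \<ge> 0"
        "\<And>x y. 0 \<le> x \<Longrightarrow> x \<le> y \<Longrightarrow> y \<le> M \<Longrightarrow> y ^ ?m - x ^ ?m \<le> L * (y - x)" by blast
      have "emeasure (distr \<mu> lborel \<pi>) {a..b} \<le> ennreal (C * L * (b - a))" if "a \<le> b" "b \<le> M" for a b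
      proof -
        have "emeasure (distr \<mu> lborel \<pi>) {a..b} = emeasure \<mu> {r \<in> R2gt. a \<le> \<pi> r \<and> \<pi> r \<le> b}"
          using \<pi>_meas by (subst emeasure_distr) (auto simp: space intro!: arg_cong2[where f = emeasure])
        also have "\<dots> \<le> ennreal (G b - G a)"
          by (rule strip) fact
        also have "\<dots> \<le> ennreal (C * L * (b - a))"
        proof (rule ennreal_leI)
          have "max 0 b ^ ?m - max 0 a ^ ?m \<le> L * (max 0 b - max 0 a)"
            using that \<open>M \<ge> 0\<close> by (intro L(2)) auto
          \<comment> \<open>The positive part is 1-Lipschitz, so the bound extends to windows that
            reach below 0.\<close>
          also have "\<dots> \<le> L * (b - a)"
            using that L(1) by (intro mult_left_mono) auto
          finally have "C * (max 0 b ^ ?m - max 0 a ^ ?m) \<le> C * (L * (b - a))"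
            using C(1) by (rule mult_left_mono)
          then show "G b - G a \<le> C * L * (b - a)"
            by (simp add: G_def right_diff_distrib mult.assoc)
        qed
        finally show ?thesis .
      qed
      then show "\<exists>L\<ge>0. \<forall>a b. -M \<le> a \<longrightarrow> a \<le> b \<longrightarrow> b \<le> M \<longrightarrow>
          emeasure (distr \<mu> lborel \<pi>) {a..b} \<le> ennreal (L * (b - a))"
        using C(1) L(1) by (intro exI[of _ "C * L"]) auto
    qed simp
  qed
  \<comment> \<open>Deaths have \<open>k = q + 1\<close>, which is always positive; births have
    \<open>k = q\<close>, which is where \<open>q > 0\<close> enters.\<close>
  show ?thesis
    using density[of fst q] density[of snd "Suc q"] by simp
qed

end
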